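(* Let $X$ be a proper geodesic metric space with a convergence boundary $\partial X$ and let $\Gamma<\mathrm{Isom}(X)$ be a non-elementary discrete subgroup. Assume that the proper action $\Gamma\curvearrowright X$ is of divergence type with a (non-pinched) contracting element, and that a discrete group $H<\mathrm{Isom}(X)$ is confined by $\Gamma$ with a finite confining subset that intersects $E(\Gamma)$ trivially. Then $\omega_H\ge\omega_\Gamma/2$.
   Context: Fix $o\in X$. Contracting: a closed $Z\subseteq X$ is $C$-contracting if $\mathrm{diam}(\pi_Z(x)\cup\pi_Z(y))\le C$ whenever $d(x,y)\le d(x,Z)$, where $\pi_Z$ is the nearest-point projection (set). An isometry $g$ is contracting if $n\mapsto g^no$ is a quasi-isometric embedding of $\mathbb Z$ with contracting image. A group is elementary if finite or virtually $\mathbb Z$. $\omega_H=\limsup_n\frac1n\log\sharp\{ho:h\in H,d(o,ho)\le n\}$. Divergence type: $\sum_{g\in\Gamma}e^{-\omega_\Gamma d(o,go)}=\infty$. Confined with finite confining subset $P$: $P\subseteq\mathrm{Isom}(X)$ is finite and $g^{-1}Hg\cap(P\setminus\{1\})\ne\emptyset$ for all $g\in\Gamma$. "Intersects $E(\Gamma)$ trivially" means $P\cap E(\Gamma)\subseteq\{1\}$. Convergence boundary: a metrizable compactification $\overline X=X\cup\partial X$ with $X$ open and dense, to which the action of $\mathrm{Isom}(X)$ extends by homeomorphisms, with an $\mathrm{Isom}(X)$-invariant partition $[\cdot]$ of $\partial X$ ($[\xi]$ is the class of $\xi$; $[A]=\bigcup_{\xi\in A}[\xi]$). A sequence tends (accumulates)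 to $[\xi]$ if its limit (all its accumulation points) lie in $[\xi]$; subsets or points $A_n$ are escaping if $d(o,A_n)\to\infty$. Required: (A) any contracting geodesic ray $\gamma$ accumulates into a closed class $[\xi]$, and any $y_n\in X$ with $\pi_\gamma(y_n)$ escaping tends to $[\xi]$. (B) for any escaping sequence of $C$-contracting quasi-geodesics $X_n$ ($C$ fixed), and any $o$, some subsequence of the cones $\Omega_o(X_n)=\{y\in X:\text{some geodesic }[o,y]\text{ meets }X_n\}$ accumulates to a class $[\xi]$, i.e. any convergent sequence $y_n\in\Omega_o(X_n)$ tends to a point of $[\xi]$. (C) the set $\mathcal C$ of non-pinched points is nonempty, where $\xi$ is non-pinched if for all sequences $x_n,y_n\in X$ converging to $[\xi]$ the segments $[x_n,y_n]$ are escaping; and for $\xi\in\mathcal C$, $[\cdot]$ is closed on $U=\Gamma[\xi]$: if $x_n,y_n\in U$, $[x_n]=[y_n]$, $x_n\to\xi'$, $y_n\to\eta'$, then $[\xi']=[\eta']$. By (A) the rays $n\mapsto f^{\pm n}o$, $n\geq 0$, of a contracting element $f$ determine classes $[f^+],[f^-]$; $f$ is non-pinched if $[f^+]\cup[f^-]\subseteq\mathcal C$. $E(\Gamma)=\{g\in\mathrm{Isom}(X): g[\xi]=[\xi]\text{ for every class }[\xi]\subseteq[\Lambda(\Gamma o)]\}$, where $\Lambda(\Gamma o)$ is the set of accumulation points of $\Gamma o$ in $\partial X$. *)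

theory Defs
  imports "HOL-Analysis.Analysis" "HOL-Algebra.Coset" "HOL-Algebra.Elementary_Groups"
begin

section \<open>Metric geometry\<close>

definition geodesic_segment :: "'a::metric_space set \<Rightarrow> 'a \<Rightarrow> 'a \<Rightarrow> bool" where
  "geodesic_segment S x y \<longleftrightarrow>
    (\<exists>\<gamma>::real \<Rightarrow> 'a. \<gamma> 0 = x \<and> \<gamma> (dist x y) = y \<and> S = \<gamma> ` {0..dist x y} \<and>
      (\<forall>s\<in>{0..dist x y}. \<forall>t\<in>{0..dist x y}. dist (\<gamma> s) (\<gamma> t) = \<bar>s - t\<bar>))"

definition geodesic_space :: "'a::metric_space itself \<Rightarrow> bool" where
  "geodesic_space _ \<longleftrightarrow> (\<forall>x y::'a. \<exists>S. geodesic_segment S x y)"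

definition geodesic_ray :: "(real \<Rightarrow> 'a::metric_space) \<Rightarrow> bool" where
  "geodesic_ray \<gamma> \<longleftrightarrow> (\<forall>s\<ge>0. \<forall>t\<ge>0. dist (\<gamma> s) (\<gamma> t) = \<bar>s - t\<bar>)"

text \<open>Quasi-isometric embedding of a subset \<open>I\<close> of the line, with both constants equal
  to \<open>L\<close>; only the existence of a constant, or its uniformity along a sequence, ever matters.\<close>

definition qi_embedding_on :: "real \<Rightarrow> real set \<Rightarrow> (real \<Rightarrow> 'a::metric_space) \<Rightarrow> bool" where
  "qi_embedding_on L I f \<longleftrightarrow> L \<ge> 1 \<and>
    (\<forall>s\<in>I. \<forall>t\<in>I. \<bar>s - t\<bar> / L - L \<le> dist (f s) (f t) \<and> dist (f s) (f t) \<le> L * \<bar>s - t\<bar> + L)"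

text \<open>Quasi-geodesics are identified with their images; segments, rays and lines are all allowed,
  and continuity is not required.\<close>

definition quasi_geodesic :: "real \<Rightarrow> 'a::metric_space set \<Rightarrow> bool" where
  "quasi_geodesic L S \<longleftrightarrow>
    (\<exists>I f. is_interval I \<and> I \<noteq> {} \<and> qi_embedding_on L I f \<and> S = f ` I)"

definition nearest_points :: "'a::metric_space set \<Rightarrow> 'a \<Rightarrow> 'a set" where
  "nearest_points Z x = {z \<in> Z. dist x z = infdist x Z}"

text \<open>\<^const>\<open>diameter\<close> is only meaningful on bounded sets, but every set of nearest
  points is bounded.\<close>

definition contracting :: "real \<Rightarrow> 'a::metric_space set \<Rightarrow> bool" where
  "contracting C Z \<longleftrightarrow> closed Z \<and>
    (\<forall>x y. dist x y \<le> infdist x Z \<longrightarrow> diameter (nearest_points Z x \<union> nearest_points Z y) \<le> C)"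

definition escaping :: "'a::metric_space \<Rightarrow> (nat \<Rightarrow> 'a set) \<Rightarrow> bool" where
  "escaping bp A \<longleftrightarrow> filterlim (\<lambda>n. infdist bp (A n)) at_top sequentially"

text \<open>The cone consists of the points seen from \<open>p\<close> through the set \<open>S\<close>.\<close>

definition cone_through :: "'a::metric_space \<Rightarrow> 'a set \<Rightarrow> 'a set" where
  "cone_through p S = {y. \<exists>T. geodesic_segment T p y \<and> T \<inter> S \<noteq> {}}"


section \<open>Isometry groups\<close>

definition Isom :: "('a::metric_space \<Rightarrow> 'a) set" where
  "Isom = {g. bij g \<and> (\<forall>x y. dist (g x) (g y) = dist x y)}"

definition isom_group :: "('a::metric_space \<Rightarrow> 'a) monoid" where
  "isom_group = \<lparr>carrier = Isom, mult = (\<circ>), one = id\<rparr>"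

lemma group_isom_group: "group (isom_group :: ('a::metric_space \<Rightarrow> 'a) monoid)"
proof (rule groupI)
  fix g :: "'a \<Rightarrow> 'a" assume g: "g \<in> carrier isom_group"
  let ?h = "inv_into UNIV g"
  have b: "bij g" and d: "\<And>x y. dist (g x) (g y) = dist x y"
    using g by (auto simp: isom_group_def Isom_def)
  have "dist (?h x) (?h y) = dist x y" for x y
    using d[of "?h x" "?h y"] b by (simp add: bij_is_surj surj_f_inv_f)
  then have "?h \<in> carrier isom_group" "?h \<circ> g = id"
    using b by (auto simp: isom_group_def Isom_def bij_imp_bij_inv bij_is_inj)
  then show "\<exists>h\<in>carrier isom_group. h \<otimes>\<^bsub>isom_group\<^esub> g = \<one>\<^bsub>isom_group\<^esub>"
    by (auto simp: isom_group_def)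
qed (auto simp: isom_group_def Isom_def bij_comp comp_assoc)

text \<open>The function space carries the topology of pointwise convergence, which on isometries
  agrees with the compact-open topology.\<close>

definition discrete_isom_subgroup :: "('a::metric_space \<Rightarrow> 'a) set \<Rightarrow> bool" where
  "discrete_isom_subgroup G \<longleftrightarrow> subgroup G isom_group \<and> discrete G"

definition virtually_Z :: "('g, 'm) monoid_scheme \<Rightarrow> bool" where
  "virtually_Z G \<longleftrightarrow>
    (\<exists>K. subgroup K G \<and> finite (rcosets\<^bsub>G\<^esub> K) \<and> G\<lparr>carrier := K\<rparr> \<cong> integer_group)"

definition elementary_group :: "('g, 'm) monoid_scheme \<Rightarrow> bool" where
  "elementary_group G \<longleftrightarrow> finite (carrier G) \<or> virtually_Z G"

definition contracting_isometry :: "'a::metric_space \<Rightarrow> ('a \<Rightarrow> 'a) \<Rightarrow> bool" where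
  "contracting_isometry bp g \<longleftrightarrow> g \<in> Isom \<and>
    (\<exists>L\<ge>1. \<forall>m n::int.
      \<bar>real_of_int m - real_of_int n\<bar> / L - L
        \<le> dist ((g [^]\<^bsub>isom_group\<^esub> m) bp) ((g [^]\<^bsub>isom_group\<^esub> n) bp) \<and>
      dist ((g [^]\<^bsub>isom_group\<^esub> m) bp) ((g [^]\<^bsub>isom_group\<^esub> n) bp)
        \<le> L * \<bar>real_of_int m - real_of_int n\<bar> + L) \<and>
    (\<exists>C. contracting C (range (\<lambda>n::int. (g [^]\<^bsub>isom_group\<^esub> n) bp)))"

definition growth_exponent :: "'a::metric_space \<Rightarrow> ('a \<Rightarrow> 'a) set \<Rightarrow> ereal" where
  "growth_exponent bp G =
    limsup (\<lambda>n. ereal (ln (real (card {h bp | h. h \<in> G \<and> dist bp (h bp) \<le> real n})) / real n))"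

text \<open>Divergence type presupposes a finite exponent: for an infinite exponent only the
  finitely many elements fixing the base point would contribute to the series, which would
  then converge. The explicit condition excludes the value \<open>real_of_ereal \<infinity> = 0\<close>.\<close>

definition divergence_type :: "'a::metric_space \<Rightarrow> ('a \<Rightarrow> 'a) set \<Rightarrow> bool" where
  "divergence_type bp G \<longleftrightarrow> \<bar>growth_exponent bp G\<bar> \<noteq> \<infinity> \<and>
    (\<Sum>\<^sub>\<infinity>g\<in>G. ennreal (exp (- real_of_ereal (growth_exponent bp G) * dist bp (g bp)))) = \<infinity>"

definition confined_by :: "('a::metric_space \<Rightarrow> 'a) set \<Rightarrow> ('a \<Rightarrow> 'a) set \<Rightarrow> ('a \<Rightarrow> 'a) set \<Rightarrow> bool" where
  "confined_by \<Gamma> H P \<longleftrightarrow> finite P \<and> P \<subseteq> Isom \<and>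
    (\<forall>g\<in>\<Gamma>. {inv\<^bsub>isom_group\<^esub> g \<circ> h \<circ> g | h. h \<in> H} \<inter> (P - {id}) \<noteq> {})"


section \<open>Convergence boundary\<close>

text \<open>The compactification is a compact metric space together with an open dense embedding
  \<open>emb\<close> of \<open>X\<close>; only the topology of the chosen compatible metric on it is used. The
  partition of the boundary is an equivalence relation \<open>R\<close> on it, so the class of
  \<open>\<xi>\<close> is \<open>R `` {\<xi>}\<close> and the saturation of a set \<open>A\<close> is \<open>R `` A\<close>.
  The extended action is \<open>act\<close>.\<close>

definition bdry :: "('a \<Rightarrow> 'b) \<Rightarrow> 'b set" where
  "bdry emb = - range emb"

definition tends_to_set :: "(nat \<Rightarrow> 'b::topological_space) \<Rightarrow> 'b set \<Rightarrow> bool" where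
  "tends_to_set x A \<longleftrightarrow> (\<exists>l\<in>A. x \<longlonglongrightarrow> l)"

definition accumulates_into :: "(nat \<Rightarrow> 'b::topological_space) \<Rightarrow> 'b set \<Rightarrow> bool" where
  "accumulates_into x A \<longleftrightarrow> (\<forall>r l. strict_mono (r::nat \<Rightarrow> nat) \<and> (x \<circ> r) \<longlonglongrightarrow> l \<longrightarrow> l \<in> A)"

definition metrizable_compactification :: "('a::metric_space \<Rightarrow> 'b::metric_space) \<Rightarrow> bool" where
  "metrizable_compactification emb \<longleftrightarrow>
    compact (UNIV :: 'b set) \<and> (\<exists>j. homeomorphism UNIV (range emb) emb j) \<and>
    open (range emb) \<and> closure (range emb) = UNIV"

definition extends_isom_action ::
  "('a::metric_space \<Rightarrow> 'b::metric_space) \<Rightarrow> (('a \<Rightarrow> 'a) \<Rightarrow> 'b \<Rightarrow> 'b) \<Rightarrow> bool" where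
  "extends_isom_action emb act \<longleftrightarrow>
    (\<forall>g\<in>Isom. (\<exists>k. homeomorphism UNIV UNIV (act g) k) \<and> (\<forall>x. act g (emb x) = emb (g x))) \<and>
    (\<forall>g\<in>Isom. \<forall>h\<in>Isom. act (g \<circ> h) = act g \<circ> act h)"

definition invariant_partition ::
  "('a::metric_space \<Rightarrow> 'b::metric_space) \<Rightarrow> (('a \<Rightarrow> 'a) \<Rightarrow> 'b \<Rightarrow> 'b) \<Rightarrow> ('b \<times> 'b) set \<Rightarrow> bool" where
  "invariant_partition emb act R \<longleftrightarrow> equiv (bdry emb) R \<and>
    (\<forall>g\<in>Isom. \<forall>\<xi>\<in>bdry emb. act g ` (R `` {\<xi>}) = R `` {act g \<xi>})"

text \<open>A sequence \<open>y\<close> with escaping projections need not converge, so the condition on it is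
  that all its accumulation points lie in the class.\<close>

definition convergence_cond_A ::
  "'a::metric_space \<Rightarrow> ('a \<Rightarrow> 'b::metric_space) \<Rightarrow> ('b \<times> 'b) set \<Rightarrow> bool" where
  "convergence_cond_A bp emb R \<longleftrightarrow>
    (\<forall>\<gamma> C. geodesic_ray \<gamma> \<and> contracting C (\<gamma> ` {0..}) \<longrightarrow>
      (\<exists>\<xi>\<in>bdry emb. closed (R `` {\<xi>}) \<and>
        (\<forall>t. (\<forall>n. 0 \<le> t n) \<and> filterlim t at_top sequentially \<longrightarrow>
          accumulates_into (\<lambda>n. emb (\<gamma> (t n))) (R `` {\<xi>})) \<and>
        (\<forall>y. escaping bp (\<lambda>n. nearest_points (\<gamma> ` {0..}) (y n)) \<longrightarrow>
          accumulates_into (\<lambda>n. emb (y n)) (R `` {\<xi>}))))"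

definition convergence_cond_B ::
  "'a::metric_space \<Rightarrow> ('a \<Rightarrow> 'b::metric_space) \<Rightarrow> ('b \<times> 'b) set \<Rightarrow> bool" where
  "convergence_cond_B bp emb R \<longleftrightarrow>
    (\<forall>C L S p. (\<forall>n. contracting C (S n) \<and> quasi_geodesic L (S n)) \<and> escaping bp S \<longrightarrow>
      (\<exists>r. strict_mono (r::nat \<Rightarrow> nat) \<and> (\<exists>\<xi>\<in>bdry emb.
        \<forall>y l. (\<forall>n. y n \<in> cone_through p (S (r n))) \<and> (\<lambda>n. emb (y n)) \<longlonglongrightarrow> l \<longrightarrow> l \<in> R `` {\<xi>})))"

definition non_pinched_points ::
  "'a::metric_space \<Rightarrow> ('a \<Rightarrow> 'b::metric_space) \<Rightarrow> ('b \<times> 'b) set \<Rightarrow> 'b set" where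
  "non_pinched_points bp emb R =
    {\<xi> \<in> bdry emb. \<forall>x y S.
      tends_to_set (\<lambda>n. emb (x n)) (R `` {\<xi>}) \<and> tends_to_set (\<lambda>n. emb (y n)) (R `` {\<xi>}) \<and>
      (\<forall>n. geodesic_segment (S n) (x n) (y n)) \<longrightarrow> escaping bp S}"

definition convergence_cond_C ::
  "'a::metric_space \<Rightarrow> ('a \<Rightarrow> 'b::metric_space) \<Rightarrow> (('a \<Rightarrow> 'a) \<Rightarrow> 'b \<Rightarrow> 'b) \<Rightarrow> ('b \<times> 'b) set \<Rightarrow>
    ('a \<Rightarrow> 'a) set \<Rightarrow> bool" where
  "convergence_cond_C bp emb act R \<Gamma> \<longleftrightarrow>
    non_pinched_points bp emb R \<noteq> {} \<and>
    (\<forall>\<xi>\<in>non_pinched_points bp emb R. \<forall>x y \<xi>' \<eta>'.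
      (\<forall>n::nat. x n \<in> (\<Union>g\<in>\<Gamma>. act g ` (R `` {\<xi>})) \<and> y n \<in> (\<Union>g\<in>\<Gamma>. act g ` (R `` {\<xi>})) \<and>
        R `` {x n} = R `` {y n}) \<and>
      x \<longlonglongrightarrow> \<xi>' \<and> y \<longlonglongrightarrow> \<eta>' \<longrightarrow> R `` {\<xi>'} = R `` {\<eta>'})"

definition convergence_boundary ::
  "'a::metric_space \<Rightarrow> ('a \<Rightarrow> 'b::metric_space) \<Rightarrow> (('a \<Rightarrow> 'a) \<Rightarrow> 'b \<Rightarrow> 'b) \<Rightarrow> ('b \<times> 'b) set \<Rightarrow>
    ('a \<Rightarrow> 'a) set \<Rightarrow> bool" where
  "convergence_boundary bp emb act R \<Gamma> \<longleftrightarrow>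
    metrizable_compactification emb \<and> extends_isom_action emb act \<and> invariant_partition emb act R \<and>
    convergence_cond_A bp emb R \<and> convergence_cond_B bp emb R \<and> convergence_cond_C bp emb act R \<Gamma>"

text \<open>For contracting \<open>f\<close> the classes \<open>R `` {\<xi>}\<close> and \<open>R `` {\<eta>}\<close> below are the
  endpoint classes of \<open>f\<close>: a class into which an orbit ray accumulates is unique, since the
  orbit ray has an accumulation point, and it exists by condition A.\<close>

definition non_pinched_isometry ::
  "'a::metric_space \<Rightarrow> ('a \<Rightarrow> 'b::metric_space) \<Rightarrow> ('b \<times> 'b) set \<Rightarrow> ('a \<Rightarrow> 'a) \<Rightarrow> bool" where
  "non_pinched_isometry bp emb R f \<longleftrightarrow>
    (\<exists>\<xi>\<in>bdry emb. \<exists>\<eta>\<in>bdry emb.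
      accumulates_into (\<lambda>n. emb ((f [^]\<^bsub>isom_group\<^esub> (int n)) bp)) (R `` {\<xi>}) \<and>
      accumulates_into (\<lambda>n. emb ((f [^]\<^bsub>isom_group\<^esub> (- int n)) bp)) (R `` {\<eta>}) \<and>
      R `` {\<xi>} \<union> R `` {\<eta>} \<subseteq> non_pinched_points bp emb R)"

definition orbit_limit_set ::
  "'a::metric_space \<Rightarrow> ('a \<Rightarrow> 'b::metric_space) \<Rightarrow> ('a \<Rightarrow> 'a) set \<Rightarrow> 'b set" where
  "orbit_limit_set bp emb \<Gamma> = {\<xi> \<in> bdry emb. \<xi> islimpt (\<lambda>g. emb (g bp)) ` \<Gamma>}"

definition elliptic_radical ::
  "'a::metric_space \<Rightarrow> ('a \<Rightarrow> 'b::metric_space) \<Rightarrow> (('a \<Rightarrow> 'a) \<Rightarrow> 'b \<Rightarrow> 'b) \<Rightarrow> ('b \<times> 'b) set \<Rightarrow>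
    ('a \<Rightarrow> 'a) set \<Rightarrow> ('a \<Rightarrow> 'a) set" where
  "elliptic_radical bp emb act R \<Gamma> =
    {g \<in> Isom. \<forall>\<xi>\<in>bdry emb.
      R `` {\<xi>} \<subseteq> R `` orbit_limit_set bp emb \<Gamma> \<longrightarrow> act g ` (R `` {\<xi>}) = R `` {\<xi>}}"

end

theory Submission
  imports Defs
begin

text \<open>For \<open>p \<in> P\<close> let \<open>Z\<^sub>p\<close> be the centralizer of \<open>p\<close> in \<open>\<Gamma>\<close>, and call a translate \<open>hA\<close> of the
  orbit axis \<open>A = {f\<^sup>n o}\<close> of the contracting element good for \<open>p\<close> if the nearest-point projection of
  \<open>Z\<^sub>p o\<close> to it is bounded. If no translate is good, then every limit class of \<open>\<Gamma>o\<close> is the limit of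
  some \<open>z\<^sub>n o\<close> with \<open>z\<^sub>n \<in> Z\<^sub>p\<close>; as \<open>p\<close> moves \<open>z\<^sub>n o\<close> by the bounded distance \<open>d(o,po)\<close>, it fixes the class,
  so \<open>p \<in> E(\<Gamma>)\<close>. Hence every \<open>p \<noteq> 1\<close> in \<open>P\<close> has a good translate. Since \<open>Z\<^sub>p\<close> is a group and goodness
  persists for axes beyond a good one, a single translate is good for all of them.

  For \<open>g \<in> \<Gamma>\<close> choose \<open>E\<close> among two fixed elements such that \<open>(gE)\<^sup>-\<^sup>1o\<close> projects far from \<open>o\<close> on this
  translate. Then \<open>d(o,gEzo) \<ge> d(o,gEo) + d(o,zo) - c\<close> for all \<open>z \<in> Z\<^sub>p\<close>. Choose \<open>p \<in> P\<close> with
  \<open>h = gEp(gE)\<^sup>-\<^sup>1 \<in> H\<close>. Two elements \<open>g\<close>, \<open>g'\<close> with the same \<open>(E,p,h)\<close> differ by some \<open>z \<in> Z\<^sub>p\<close>, and applying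
  the inequality in both directions bounds \<open>d(o,zo)\<close>. So \<open>g \<mapsto> (E,p,h)\<close> is boundedly many-to-one with
  \<open>d(o,ho) \<le> 2d(o,go) + M\<close>.\<close>

section \<open>Projections to contracting sets\<close>

lemma contracting_mono: "contracting C Z \<Longrightarrow> C \<le> D \<Longrightarrow> contracting D Z"
  unfolding contracting_def by (meson order_trans)

lemma geodesic_segmentE:
  assumes "geodesic_segment S x y"
  obtains \<gamma> where "\<gamma> 0 = x" "\<gamma> (dist x y) = y" "S = \<gamma> ` {0..dist x y}"
    "\<And>s t. \<lbrakk>0 \<le> s; s \<le> dist x y; 0 \<le> t; t \<le> dist x y\<rbrakk> \<Longrightarrow> dist (\<gamma> s) (\<gamma> t) = \<bar>s - t\<bar>"
  using assms unfolding geodesic_segment_def by force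

text \<open>The sort \<open>heine_borel\<close> expresses properness and makes nearest points exist.
  A positive \<open>C\<close> can always be arranged by \<open>contracting_mono\<close>, and
  \<open>2 * C\<close> then serves as a step length along geodesics.\<close>

locale contracting_subset =
  fixes C :: real and Z :: "'a::heine_borel set"
  assumes geod: "geodesic_space TYPE('a)" and contr: "contracting C Z"
    and ne: "Z \<noteq> {}" and C_pos: "C > 0"
begin

lemma nearest_points_nonempty: "nearest_points Z x \<noteq> {}"
proof -
  have "closed Z" using contr by (auto simp: contracting_def)
  then obtain z where "z \<in> Z" "infdist x Z = dist x z"
    using infdist_attains_inf[of Z x] ne by metis
  then show ?thesis by (auto simp: nearest_points_def)
qed

lemma nearest_pointE: obtains a where "a \<in> nearest_points Z x"
  using nearest_points_nonempty by blast

lemma nearest_pointD: "a \<in> nearest_points Z x \<Longrightarrow> a \<in> Z \<and> dist x a = infdist x Z"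
  by (auto simp: nearest_points_def)

lemma self_nearest: "x \<in> Z \<Longrightarrow> x \<in> nearest_points Z x"
  by (auto simp: nearest_points_def)

lemma bounded_nearest_points: "bounded (nearest_points Z x)"
  unfolding bounded_def nearest_points_def by (auto intro!: exI[of _ x])

lemma projection_close:
  assumes "dist x y \<le> infdist x Z" "a \<in> nearest_points Z x" "b \<in> nearest_points Z y"
  shows "dist a b \<le> C"
proof -
  have "dist a b \<le> diameter (nearest_points Z x \<union> nearest_points Z y)"
    using assms by (intro diameter_bounded_bound) (auto simp: bounded_nearest_points)
  then show ?thesis using contr assms(1) unfolding contracting_def by force
qed

lemma nearest_points_close:
  assumes "a \<in> nearest_points Z x" "b \<in> nearest_points Z x"
  shows "dist a b \<le> C"
  using projection_close[of x x a b] assms infdist_nonneg[of x Z] by simp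

text \<open>At distance at least \<open>2 * C\<close> from \<open>Z\<close>, a step of length
  \<open>2 * C\<close> moves the projection by at most \<open>C\<close>, so projections travel at
  half speed. The extra \<open>C\<close> is the spread of the nearest points of a single point, met
  when \<open>n = 0\<close>.\<close>

lemma projection_drift:
  fixes \<gamma> :: "real \<Rightarrow> 'a"
  assumes iso: "\<And>s t. \<lbrakk>0 \<le> s; s \<le> T; 0 \<le> t; t \<le> T\<rbrakk> \<Longrightarrow> dist (\<gamma> s) (\<gamma> t) = \<bar>s - t\<bar>"
    and far: "\<And>t. \<lbrakk>0 \<le> t; t \<le> T\<rbrakk> \<Longrightarrow> infdist (\<gamma> t) Z \<ge> 2 * C"
    and "0 \<le> s" "s \<le> t" "t \<le> T" "t - s \<le> real n * (2 * C)"
    and "a \<in> nearest_points Z (\<gamma> s)" "b \<in> nearest_points Z (\<gamma> t)"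
  shows "dist a b \<le> (real n + 1) * C"
  using assms(3-)
proof (induction n arbitrary: t b)
  case 0
  then have "dist a b \<le> C" by (intro nearest_points_close[of _ "\<gamma> s"]) auto
  then show ?case by simp
next
  case (Suc n)
  define r where "r = max s (t - 2 * C)"
  obtain c where c: "c \<in> nearest_points Z (\<gamma> r)" by (rule nearest_pointE)
  have r: "s \<le> r" "r \<le> t" "t - r \<le> 2 * C" "r - s \<le> real n * (2 * C)"
    using Suc.prems C_pos unfolding r_def by (auto simp: algebra_simps max_def)
  have "dist a c \<le> (real n + 1) * C"
    using Suc.IH[of r c] r c Suc.prems by auto
  moreover have "dist (\<gamma> r) (\<gamma> t) \<le> infdist (\<gamma> r) Z"
    using iso[of r t] far[of r] r Suc.prems by auto
  then have "dist c b \<le> C" using projection_close c Suc.prems by blast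
  ultimately show ?case using dist_triangle[of a b c] by (simp add: algebra_simps)
qed

text \<open>By the triangle inequality the part of the geodesic outside the balls of radius
  \<open>r\<close> and \<open>s\<close> about its ends is no longer than \<open>dist a b\<close>.
  Its projection covers at most half that length up to a constant, which is impossible when
  \<open>dist a b\<close> is large.\<close>

lemma far_geodesic:
  fixes \<gamma> :: "real \<Rightarrow> 'a"
  assumes iso: "\<And>s t. \<lbrakk>0 \<le> s; s \<le> T; 0 \<le> t; t \<le> T\<rbrakk> \<Longrightarrow> dist (\<gamma> s) (\<gamma> t) = \<bar>s - t\<bar>"
    and far: "\<And>t. \<lbrakk>0 \<le> t; t \<le> T\<rbrakk> \<Longrightarrow> infdist (\<gamma> t) Z \<ge> 2 * C"
    and T: "0 \<le> T"
    and a: "a \<in> nearest_points Z (\<gamma> 0)" and b: "b \<in> nearest_points Z (\<gamma> T)"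
  shows "dist a b \<le> 8 * C"
proof -
  define r s where "r = infdist (\<gamma> 0) Z" and "s = infdist (\<gamma> T) Z"
  have r: "r \<ge> 2 * C" and s: "s \<ge> 2 * C" using far[of 0] far[of T] T by (auto simp: r_def s_def)
  have ra: "dist (\<gamma> 0) a = r" and sb: "dist (\<gamma> T) b = s"
    using a b nearest_pointD by (auto simp: r_def s_def)
  show ?thesis
  proof (cases "r + s \<ge> T")
    case True
    \<comment> \<open>The two end balls meet at \<open>\<gamma> t\<close>, and from the centre of
      either ball to this point the projection moves by at most \<open>C\<close>.\<close>
    define t where "t = min r T"
    have t: "0 \<le> t" "t \<le> T" "t \<le> r" "T - t \<le> s"
      using True r s C_pos T by (auto simp: t_def)
    obtain c where c: "c \<in> nearest_points Z (\<gamma> t)" by (rule nearest_pointE)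
    have "dist (\<gamma> 0) (\<gamma> t) \<le> infdist (\<gamma> 0) Z" using iso[of 0 t] t T by (auto simp: r_def)
    then have 1: "dist a c \<le> C" using projection_close a c by blast
    have "dist (\<gamma> T) (\<gamma> t) \<le> infdist (\<gamma> T) Z" using iso[of T t] t T by (auto simp: s_def)
    then have "dist b c \<le> C" using projection_close b c by blast
    then show ?thesis using 1 dist_triangle2[of a b c] C_pos by simp
  next
    case False
    obtain c where c: "c \<in> nearest_points Z (\<gamma> r)" by (rule nearest_pointE)
    obtain d where d: "d \<in> nearest_points Z (\<gamma> (T - s))" by (rule nearest_pointE)
    have "dist (\<gamma> 0) (\<gamma> r) \<le> infdist (\<gamma> 0) Z" using iso[of 0 r] False r s C_pos by (auto simp: r_def)
    then have 1: "dist a c \<le> C" using projection_close a c by blast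
    have "dist (\<gamma> T) (\<gamma> (T - s)) \<le> infdist (\<gamma> T) Z" using iso[of T "T - s"] False r s C_pos by (auto simp: s_def)
    then have 2: "dist b d \<le> C" using projection_close b d by blast
    \<comment> \<open>The number of steps of length \<open>2 * C\<close> covering the middle part.
      Rounding up costs at most one step; with the extra \<open>C\<close> of
      \<open>projection_drift\<close> this gives the \<open>4 * C\<close> in the bound for
      \<open>2 * dist c d\<close>.\<close>
    define n where "n = nat \<lceil>(T - s - r) / (2 * C)\<rceil>"
    have "(T - s - r) / (2 * C) \<le> real n" unfolding n_def by linarith
    then have n1: "T - s - r \<le> real n * (2 * C)" using C_pos by (simp add: field_simps)
    have "(T - s - r) / (2 * C) \<ge> 0" using False C_pos by simp
    then have "real n \<le> (T - s - r) / (2 * C) + 1" unfolding n_def by linarith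
    then have "real n * (2 * C) \<le> ((T - s - r) / (2 * C) + 1) * (2 * C)"
      using C_pos by (intro mult_right_mono) auto
    then have n2: "real n * (2 * C) \<le> T - s - r + 2 * C" using C_pos by (simp add: distrib_right)
    have "dist c d \<le> (real n + 1) * C"
      using projection_drift[where T=T and \<gamma>=\<gamma> and s=r and t="T - s" and n=n and a=c and b=d, OF iso far] n1 c d False r s C_pos by auto
    then have 3: "2 * dist c d \<le> T - s - r + 4 * C" using n2 by (simp add: algebra_simps)
    have "T \<le> dist (\<gamma> 0) a + dist a b + dist b (\<gamma> T)"
      using iso[of 0 T] T dist_triangle[of "\<gamma> 0" "\<gamma> T" a] dist_triangle[of a "\<gamma> T" b] by auto
    then have "T - s - r \<le> dist a b" using ra sb by (simp add: dist_commute)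
    moreover have "dist a b \<le> dist c d + 2 * C"
      using 1 2 dist_triangle[of a b c] dist_triangle[of c b d] by (simp add: dist_commute)
    ultimately show ?thesis using 3 by simp
  qed
qed

text \<open>Before the first time \<open>u\<close> within \<open>2 * C\<close> of \<open>Z\<close>,
  \<open>far_geodesic\<close> bounds the drift of the projection by \<open>8 * C\<close>; another
  \<open>2 * C\<close> lead from the projection back to \<open>\<gamma> u\<close>. Minimality of
  \<open>u\<close> later orders the entries from the two ends.\<close>

lemma first_entry:
  fixes \<gamma> :: "real \<Rightarrow> 'a"
  assumes iso: "\<And>s t. \<lbrakk>0 \<le> s; s \<le> T; 0 \<le> t; t \<le> T\<rbrakk> \<Longrightarrow> dist (\<gamma> s) (\<gamma> t) = \<bar>s - t\<bar>"
    and ex: "0 \<le> t0" "t0 \<le> T" "infdist (\<gamma> t0) Z \<le> 2 * C"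
    and a: "a \<in> nearest_points Z (\<gamma> 0)"
  obtains u where "0 \<le> u" "u \<le> T" "dist (\<gamma> u) a \<le> 10 * C"
    "\<And>t. \<lbrakk>0 \<le> t; t \<le> T; infdist (\<gamma> t) Z \<le> 2 * C\<rbrakk> \<Longrightarrow> u \<le> t"
proof -
  define S where "S = {t \<in> {0..T}. infdist (\<gamma> t) Z \<le> 2 * C}"
  define u where "u = Inf S"
  have S: "t0 \<in> S" "bdd_below S" using ex by (auto simp: S_def intro!: bdd_belowI[of _ 0])
  have u_le: "u \<le> t" if "t \<in> S" for t using that S unfolding u_def by (intro cInf_lower)
  have u0: "0 \<le> u" unfolding u_def using S by (intro cInf_greatest) (auto simp: S_def)
  have uT: "u \<le> T" using u_le[OF S(1)] ex by simp
  have lip: "\<bar>infdist (\<gamma> s) Z - infdist (\<gamma> t) Z\<bar> \<le> \<bar>s - t\<bar>"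
    if "0 \<le> s" "s \<le> T" "0 \<le> t" "t \<le> T" for s t
    using infdist_triangle_abs[of "\<gamma> s" Z "\<gamma> t"] iso that by auto
  have u_near: "infdist (\<gamma> u) Z \<le> 2 * C"
  proof (rule field_le_epsilon)
    fix e :: real assume "e > 0"
    then obtain t where t: "t \<in> S" "t < u + e"
      using cInf_lessD[of S "u + e"] S by (auto simp: u_def)
    then show "infdist (\<gamma> u) Z \<le> 2 * C + e"
      using lip[of u t] u_le[OF t(1)] u0 uT by (auto simp: S_def)
  qed
  \<comment> \<open>At \<open>t = u\<close> the bound is a limit of the bounds at earlier times,
    which exist because \<open>u > 0\<close>.\<close>
  have far: "infdist (\<gamma> t) Z \<ge> 2 * C" if "0 \<le> t" "t \<le> u" "u > 0" for t
  proof (cases "t < u")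
    case True
    then show ?thesis using u_le[of t] that uT by (force simp: S_def)
  next
    case False
    then have t: "t = u" using that by simp
    show ?thesis
    proof (rule field_le_epsilon)
      fix e :: real assume "e > 0"
      define s where "s = max 0 (u - e)"
      have "s \<notin> S" using u_le[of s] \<open>e > 0\<close> that by (auto simp: s_def)
      then have "infdist (\<gamma> s) Z > 2 * C" using u0 uT \<open>e > 0\<close> by (auto simp: S_def s_def)
      then show "2 * C \<le> infdist (\<gamma> t) Z + e"
        using lip[of s u] u0 uT \<open>e > 0\<close> unfolding t by (auto simp: s_def)
    qed
  qed
  have "dist (\<gamma> u) a \<le> 10 * C"
  proof (cases "u = 0")
    case True
    then show ?thesis using nearest_pointD[OF a] u_near C_pos by simp
  next
    case False
    obtain b where b: "b \<in> nearest_points Z (\<gamma> u)" by (rule nearest_pointE)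
    have "dist a b \<le> 8 * C"
      using False u0 uT by (intro far_geodesic[of u \<gamma>] iso far a b) auto
    then show ?thesis
      using nearest_pointD[OF b] u_near dist_triangle[of "\<gamma> u" a b] by (simp add: dist_commute)
  qed
  then show ?thesis using that[of u] u0 uT u_le by (auto simp: S_def)
qed

text \<open>\<open>first_entry\<close> is applied to the geodesic and to its reversal. Both entry
  times are compared with the same near time \<open>t0\<close>, which puts them in the right
  order.\<close>

lemma geodesic_meets_projections:
  fixes \<gamma> :: "real \<Rightarrow> 'a"
  assumes iso: "\<And>s t. \<lbrakk>0 \<le> s; s \<le> T; 0 \<le> t; t \<le> T\<rbrakk> \<Longrightarrow> dist (\<gamma> s) (\<gamma> t) = \<bar>s - t\<bar>"
    and T: "0 \<le> T"
    and a: "a \<in> nearest_points Z (\<gamma> 0)" and b: "b \<in> nearest_points Z (\<gamma> T)"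
    and ab: "dist a b > 8 * C"
  obtains u v where "0 \<le> u" "u \<le> v" "v \<le> T" "dist (\<gamma> u) a \<le> 10 * C" "dist (\<gamma> v) b \<le> 10 * C"
proof -
  obtain t0 where t0: "0 \<le> t0" "t0 \<le> T" "infdist (\<gamma> t0) Z \<le> 2 * C"
    using far_geodesic[OF iso _ T a b] ab by force
  obtain u where u: "0 \<le> u" "u \<le> T" "dist (\<gamma> u) a \<le> 10 * C"
    "\<And>t. \<lbrakk>0 \<le> t; t \<le> T; infdist (\<gamma> t) Z \<le> 2 * C\<rbrakk> \<Longrightarrow> u \<le> t"
    using first_entry[OF iso t0 a] by blast
  define \<delta> where "\<delta> t = \<gamma> (T - t)" for t
  have iso': "dist (\<delta> s) (\<delta> t) = \<bar>s - t\<bar>" if "0 \<le> s" "s \<le> T" "0 \<le> t" "t \<le> T" for s t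
    using iso[of "T - s" "T - t"] that by (simp add: \<delta>_def)
  have b': "b \<in> nearest_points Z (\<delta> 0)" using b by (simp add: \<delta>_def)
  have t0': "0 \<le> T - t0" "T - t0 \<le> T" "infdist (\<delta> (T - t0)) Z \<le> 2 * C"
    using t0 by (auto simp: \<delta>_def)
  obtain v where v: "0 \<le> v" "v \<le> T" "dist (\<delta> v) b \<le> 10 * C"
    "\<And>t. \<lbrakk>0 \<le> t; t \<le> T; infdist (\<delta> t) Z \<le> 2 * C\<rbrakk> \<Longrightarrow> v \<le> t"
    using first_entry[OF iso' t0' b'] by blast
  have "v \<le> T - t0" using v(4)[of "T - t0"] t0' by blast
  moreover have "u \<le> t0" using u(4)[of t0] t0 by blast
  ultimately have "u \<le> T - v" by linarith
  then show ?thesis using that[of u "T - v"] u(1,3) v(1,3) by (auto simp: \<delta>_def)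
qed

text \<open>The geodesic passes within \<open>10 * C\<close> of \<open>a\<close> and afterwards of
  \<open>b\<close>. Going to \<open>a\<close> and back, and to \<open>b\<close> and back, costs
  \<open>10 * C\<close> four times.\<close>

lemma projection_inequality:
  assumes a: "a \<in> nearest_points Z x" and b: "b \<in> nearest_points Z y" and ab: "dist a b > 8 * C"
  shows "dist x a + dist a b + dist b y \<le> dist x y + 40 * C"
proof -
  obtain S where "geodesic_segment S x y" using geod by (auto simp: geodesic_space_def)
  then obtain \<gamma> where \<gamma>: "\<gamma> 0 = x" "\<gamma> (dist x y) = y"
    "\<And>s t. \<lbrakk>0 \<le> s; s \<le> dist x y; 0 \<le> t; t \<le> dist x y\<rbrakk> \<Longrightarrow> dist (\<gamma> s) (\<gamma> t) = \<bar>s - t\<bar>"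
    by (elim geodesic_segmentE) metis
  obtain u v where uv: "0 \<le> u" "u \<le> v" "v \<le> dist x y"
    "dist (\<gamma> u) a \<le> 10 * C" "dist (\<gamma> v) b \<le> 10 * C"
    using geodesic_meets_projections[where T="dist x y" and \<gamma>=\<gamma> and a=a and b=b] a b ab \<gamma> by auto
  have "dist x (\<gamma> u) = u" "dist (\<gamma> u) (\<gamma> v) = v - u" "dist (\<gamma> v) y = dist x y - v"
    using \<gamma>(3)[of 0 u] \<gamma>(3)[of u v] \<gamma>(3)[of v "dist x y"] \<gamma>(1,2) uv by auto
  then show ?thesis
    using uv dist_triangle[of x a "\<gamma> u"] dist_triangle[of a b "\<gamma> u"]
      dist_triangle[of "\<gamma> u" b "\<gamma> v"] dist_triangle[of b y "\<gamma> v"]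
    by (simp add: dist_commute)
qed

lemma projection_lipschitz:
  assumes "a \<in> nearest_points Z x" "b \<in> nearest_points Z y"
  shows "dist a b \<le> dist x y + 40 * C"
proof (cases "dist a b > 8 * C")
  case True
  then show ?thesis using projection_inequality[OF assms True]
    zero_le_dist[of x a] zero_le_dist[of b y] by linarith
next
  case False
  then show ?thesis using C_pos zero_le_dist[of x y] by linarith
qed

lemma geodesic_near_projection:
  assumes S: "geodesic_segment S x y"
    and a: "a \<in> nearest_points Z x" and b: "b \<in> nearest_points Z y" and ab: "dist a b > 8 * C"
  obtains w where "w \<in> S" "dist w b \<le> 10 * C"
proof -
  obtain \<gamma> where \<gamma>: "\<gamma> 0 = x" "\<gamma> (dist x y) = y" "S = \<gamma> ` {0..dist x y}"
    "\<And>s t. \<lbrakk>0 \<le> s; s \<le> dist x y; 0 \<le> t; t \<le> dist x y\<rbrakk> \<Longrightarrow> dist (\<gamma> s) (\<gamma> t) = \<bar>s - t\<bar>"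
    using S by (elim geodesic_segmentE) metis
  obtain u v where "0 \<le> u" "u \<le> v" "v \<le> dist x y" "dist (\<gamma> v) b \<le> 10 * C"
    by (rule geodesic_meets_projections[where T="dist x y" and \<gamma>=\<gamma> and a=a and b=b])
      (use a b ab \<gamma> in auto)
  then show ?thesis using that[of "\<gamma> v"] \<gamma>(3) by auto
qed

text \<open>Quasi-convexity of \<open>Z\<close>; equality in the triangle inequality says that
  \<open>w\<close> lies between \<open>x\<close> and \<open>y\<close>. On a side where the
  projections differ by more than \<open>8 * C\<close>, \<open>projection_inequality\<close>
  applies; on any other side the projections are close, and the distance of \<open>w\<close> to that
  endpoint bounds \<open>\<rho>\<close>.\<close>

lemma between_close_points:
  assumes b: "dist x w + dist w y = dist x y"
    and x: "infdist x Z \<le> D" and y: "infdist y Z \<le> D"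
  shows "infdist w Z \<le> 2 * D + 40 * C"
proof -
  obtain p q r where p: "p \<in> nearest_points Z x" and q: "q \<in> nearest_points Z y"
    and r: "r \<in> nearest_points Z w" by (meson nearest_pointE)
  define \<rho> where "\<rho> = infdist w Z"
  have d: "dist x p \<le> D" "dist q y \<le> D" "dist w r = \<rho>" "dist r w = \<rho>"
    using nearest_pointD[OF p] nearest_pointD[OF q] nearest_pointD[OF r] x y
    by (auto simp: \<rho>_def dist_commute)
  have xy: "dist x y \<le> 2 * D + dist p q"
    using d dist_triangle[of x y p] dist_triangle[of p y q] by linarith
  have pq: "dist p q \<le> dist p r + dist r q" by (rule dist_triangle)
  have xw: "\<rho> \<le> dist x w + D" and yw: "\<rho> \<le> dist w y + D"
    using infdist_triangle[of w Z x] infdist_triangle[of w Z y] x y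
    by (auto simp: \<rho>_def dist_commute)
  have D0: "D \<ge> 0" using d(1) zero_le_dist[of x p] by linarith
  have dpr: "dist x p \<ge> 0" "dist q y \<ge> 0" by auto
  consider "dist p r > 8 * C" "dist r q > 8 * C" | "dist p r \<le> 8 * C" "dist r q \<le> 8 * C"
    | "dist p r \<le> 8 * C" "dist r q > 8 * C" | "dist p r > 8 * C" "dist r q \<le> 8 * C" by linarith
  then have "\<rho> \<le> 2 * D + 40 * C"
  proof cases
    case 1
    from projection_inequality[OF p r 1(1)] projection_inequality[OF r q 1(2)]
    show ?thesis using d b xy pq dpr D0 C_pos by linarith
  next
    case 2
    then show ?thesis using xy pq b xw yw D0 C_pos by linarith
  next
    case 3
    from projection_inequality[OF r q 3(2)]
    show ?thesis using d b xy pq dpr D0 C_pos xw 3(1) by linarith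
  next
    case 4
    from projection_inequality[OF p r 4(1)]
    show ?thesis using d b xy pq dpr D0 C_pos yw 4(2) by linarith
  qed
  then show ?thesis by (simp add: \<rho>_def)
qed

end

section \<open>Translates of a contracting axis\<close>

lemma nearest_points_isometry:
  assumes "\<And>x y. dist (g x) (g y) = dist x y"
  shows "nearest_points (g ` Z) (g x) = g ` nearest_points Z x"
proof -
  have "infdist (g x) (g ` Z) = infdist x Z"
    by (simp add: infdist_def image_image assms)
  then show ?thesis by (auto simp: nearest_points_def assms)
qed

lemma contracting_isometry_image:
  fixes g :: "'a::metric_space \<Rightarrow> 'a"
  assumes iso: "\<And>x y. dist (g x) (g y) = dist x y" and "surj g" and Z: "contracting C Z"
  shows "contracting C (g ` Z)"
proof -
  have inf: "infdist (g x) (g ` Z) = infdist x Z" for x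
    by (simp add: infdist_def image_image iso)
  have diam: "diameter (g ` S) = diameter S" for S
    unfolding diameter_def by (simp add: image_paired_Times[symmetric] image_image iso case_prod_beta)
  have "closed (g ` Z)"
  proof -
    have "continuous_on UNIV (inv_into UNIV g)"
    proof -
      have "dist (inv_into UNIV g x) (inv_into UNIV g y) = dist x y" for x y
        using iso[of "inv_into UNIV g x" "inv_into UNIV g y"] \<open>surj g\<close> by (simp add: surj_f_inv_f)
      then show ?thesis unfolding continuous_on_iff by metis
    qed
    moreover have "inj g" by (metis dist_eq_0_iff injI iso)
    then have "g ` Z = inv_into UNIV g -` Z"
      using \<open>surj g\<close> by (auto simp: surj_f_inv_f inv_f_f image_iff) (metis surj_f_inv_f)
    ultimately show ?thesis
      using Z by (auto simp: contracting_def intro: continuous_closed_vimage continuous_on_imp_continuous_within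
        simp: continuous_on_eq_continuous_within)
  qed
  moreover have "diameter (nearest_points (g ` Z) x \<union> nearest_points (g ` Z) y) \<le> C"
    if "dist x y \<le> infdist x (g ` Z)" for x y
  proof -
    obtain x' y' where xy: "x = g x'" "y = g y'" using \<open>surj g\<close> by (metis surj_def)
    then have "diameter (nearest_points Z x' \<union> nearest_points Z y') \<le> C"
      using that Z by (auto simp: contracting_def iso inf)
    then show ?thesis
      by (simp add: xy nearest_points_isometry[OF iso] image_Un[symmetric] diam)
  qed
  ultimately show ?thesis by (auto simp: contracting_def)
qed

section \<open>Sets with bounded projection to a contracting set\<close>

definition projects_boundedly :: "'a::metric_space set \<Rightarrow> 'a set \<Rightarrow> bool" where
  "projects_boundedly S Y \<longleftrightarrow> bounded (\<Union>y\<in>Y. nearest_points S y)"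

lemma projects_boundedly_iff:
  "projects_boundedly S Y \<longleftrightarrow> (\<exists>R. \<forall>y\<in>Y. \<forall>a\<in>nearest_points S y. dist p a \<le> R)"
  unfolding projects_boundedly_def bounded_any_center[of _ p] by auto

text \<open>For contracting \<open>S\<close> this is equivalent to \<^const>\<open>projects_boundedly\<close>, but it is visibly
  invariant under perturbing \<open>S\<close> by a bounded distance.\<close>

definition avoids :: "'a::metric_space \<Rightarrow> 'a set \<Rightarrow> 'a set \<Rightarrow> bool" where
  "avoids p S Y \<longleftrightarrow>
    (\<forall>E. \<exists>R. \<forall>b\<in>S. \<forall>y\<in>Y. dist p b + dist b y \<le> dist p y + E \<longrightarrow> dist p b \<le> R)"

text \<open>Replacing \<open>b\<close> by \<open>s\<close> changes each of the two distances on the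
  left by at most \<open>c\<close>, hence the slack \<open>E + 2 * c\<close>.\<close>

lemma avoids_near:
  assumes "avoids p S Y" and near: "\<And>b. b \<in> T \<Longrightarrow> \<exists>s\<in>S. dist b s \<le> c"
  shows "avoids p T Y"
  unfolding avoids_def
proof
  fix E
  obtain R where R: "\<And>b y. b \<in> S \<Longrightarrow> y \<in> Y \<Longrightarrow> dist p b + dist b y \<le> dist p y + (E + 2 * c) \<Longrightarrow> dist p b \<le> R"
    using assms(1) unfolding avoids_def by meson
  have "dist p b \<le> R + c"
    if b: "b \<in> T" and y: "y \<in> Y" and E: "dist p b + dist b y \<le> dist p y + E" for b y
  proof -
    obtain s where s: "s \<in> S" "dist b s \<le> c" using near[OF b] by blast
    then have "dist p s \<le> R"
      using E dist_triangle[of p s b] dist_triangle[of s y b]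
      by (intro R[OF s(1) y]) (simp add: dist_commute)
    then show ?thesis using s dist_triangle[of p b s] by (simp add: dist_commute)
  qed
  then show "\<exists>R. \<forall>b\<in>T. \<forall>y\<in>Y. dist p b + dist b y \<le> dist p y + E \<longrightarrow> dist p b \<le> R" by blast
qed

context contracting_subset
begin

text \<open>A path from \<open>y\<close> to a point \<open>b\<close> of \<open>Z\<close> passes near
  the projection \<open>a\<close> of \<open>y\<close>, so if \<open>b\<close> is almost between
  \<open>p\<close> and \<open>y\<close>, it is not much farther from \<open>p\<close> than
  \<open>a\<close>. Conversely, a projection \<open>a\<close> far from that of \<open>p\<close> is
  itself almost between \<open>p\<close> and \<open>y\<close>, with slack
  \<open>40 * C\<close>.\<close>

lemma projects_boundedly_iff_avoids: "projects_boundedly Z Y \<longleftrightarrow> avoids p Z Y"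
proof
  assume "projects_boundedly Z Y"
  then obtain R where R: "\<And>y a. y \<in> Y \<Longrightarrow> a \<in> nearest_points Z y \<Longrightarrow> dist p a \<le> R"
    unfolding projects_boundedly_iff[of _ _ p] by blast
  have "dist p b \<le> R + 40 * C + \<bar>E\<bar>"
    if b: "b \<in> Z" and y: "y \<in> Y" and E: "dist p b + dist b y \<le> dist p y + E" for b y E
  proof -
    obtain a where a: "a \<in> nearest_points Z y" by (rule nearest_pointE)
    show ?thesis
    proof (cases "dist a b > 8 * C")
      case True
      then show ?thesis
        using projection_inequality[OF a self_nearest[OF b] True] E R[OF y a]
          dist_triangle[of p y a] C_pos by (simp add: dist_commute)
    next
      case False
      then show ?thesis using R[OF y a] dist_triangle[of p b a] C_pos by linarith
    qed
  qed
  then show "avoids p Z Y" unfolding avoids_def by meson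
next
  assume "avoids p Z Y"
  then obtain R where
    R: "\<And>b y. b \<in> Z \<Longrightarrow> y \<in> Y \<Longrightarrow> dist p b + dist b y \<le> dist p y + 40 * C \<Longrightarrow> dist p b \<le> R"
    unfolding avoids_def by meson
  obtain q where q: "q \<in> nearest_points Z p" by (rule nearest_pointE)
  have "dist p a \<le> max R (dist p q + 8 * C)" if y: "y \<in> Y" and a: "a \<in> nearest_points Z y" for y a
  proof (cases "dist q a > 8 * C")
    case True
    then have "dist p a \<le> R"
      using projection_inequality[OF q a True] nearest_pointD[OF a] dist_triangle[of p a q]
      by (intro R[OF _ y]) auto
    then show ?thesis by simp
  next
    case False
    then show ?thesis using dist_triangle[of p a q] by linarith
  qed
  then show "projects_boundedly Z Y" unfolding projects_boundedly_iff[of _ _ p] by blast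
qed

text \<open>A far projection \<open>b\<close> of \<open>y\<close> to \<open>T\<close> would be
  almost between \<open>p\<close> and \<open>y\<close>. But the ways from \<open>p\<close> to
  \<open>b\<close> and from \<open>b\<close> to \<open>y\<close> both pass near the projection
  \<open>c\<close> of \<open>b\<close> to \<open>Z\<close>, which is far from \<open>p\<close> and
  from the projection of \<open>y\<close>; such a detour is too long.\<close>

lemma projects_boundedly_beyond:
  assumes Y: "projects_boundedly Z Y"
  obtains \<rho> where "\<And>T. \<lbrakk>contracting_subset C T;
    \<And>b c. b \<in> T \<Longrightarrow> c \<in> nearest_points Z b \<Longrightarrow> dist p c \<ge> \<rho>\<rbrakk> \<Longrightarrow> projects_boundedly T Y"
proof -
  obtain R where R: "\<And>y a. y \<in> Y \<Longrightarrow> a \<in> nearest_points Z y \<Longrightarrow> dist p a \<le> R"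
    using Y unfolding projects_boundedly_iff[of _ _ p] by blast
  obtain a where a: "a \<in> nearest_points Z p" by (rule nearest_pointE)
  \<comment> \<open>Three uses of \<open>projection_inequality\<close> cost \<open>120 * C\<close>
    in total, and \<open>dist q c\<close>, which is at least \<open>\<rho> - R\<close>, has to
    exceed \<open>R + 120 * C\<close>.\<close>
  define \<rho> where "\<rho> = 2 * \<bar>R\<bar> + 130 * C + dist p a"
  have "projects_boundedly T Y" if T: "contracting_subset C T"
    and far: "\<And>b c. b \<in> T \<Longrightarrow> c \<in> nearest_points Z b \<Longrightarrow> dist p c \<ge> \<rho>" for T
  proof -
    interpret T: contracting_subset C T by (rule T)
    obtain s where s: "s \<in> nearest_points T p" by (rule T.nearest_pointE)
    have "dist p b \<le> dist p s + 8 * C" if y: "y \<in> Y" and b: "b \<in> nearest_points T y" for y b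
    proof (rule ccontr)
      assume "\<not> ?thesis"
      then have "dist s b > 8 * C" using dist_triangle[of p b s] by linarith
      from T.projection_inequality[OF s b this]
      have 1: "dist p b + dist b y \<le> dist p y + 40 * C" using dist_triangle[of p b s] by linarith
      obtain c where c: "c \<in> nearest_points Z b" by (rule nearest_pointE)
      obtain q where q: "q \<in> nearest_points Z y" by (rule nearest_pointE)
      have pc: "dist p c \<ge> \<rho>" using far T.nearest_pointD[OF b] c by blast
      have pq: "dist p q \<le> R" by (rule R[OF y q])
      have "dist a c > 8 * C" "dist q c > 8 * C"
        using pc pq dist_triangle[of p c a] dist_triangle[of p c q] C_pos zero_le_dist[of p q] zero_le_dist[of p a]
        unfolding \<rho>_def by linarith+
      from projection_inequality[OF a c this(1)] projection_inequality[OF q c this(2)]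
      show False
        using 1 pc pq dist_triangle[of p y q] dist_triangle[of p c q] C_pos
          zero_le_dist[of p a] zero_le_dist[of a c] zero_le_dist[of c b] dist_commute[of y q] dist_commute[of y b]
        unfolding \<rho>_def by linarith
    qed
    then show ?thesis unfolding projects_boundedly_iff[of _ _ p] by blast
  qed
  then show ?thesis by (rule that)
qed

end

section \<open>The orbit axis of a contracting element and its translates\<close>

locale orbit_axis =
  fixes bp :: "'a::heine_borel" and G :: "('a \<Rightarrow> 'a) set" and F :: "int \<Rightarrow> 'a \<Rightarrow> 'a" and L C :: real
  assumes geod: "geodesic_space TYPE('a)"
    and G_Isom: "G \<subseteq> Isom"
    and comp_closed: "\<lbrakk>g \<in> G; h \<in> G\<rbrakk> \<Longrightarrow> g \<circ> h \<in> G"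
    and inv_closed: "g \<in> G \<Longrightarrow> inv_into UNIV g \<in> G"
    and finite_ball: "finite {g \<in> G. dist bp (g bp) \<le> r}"
    and F_mem: "F n \<in> G" and F_0: "F 0 = id" and F_add: "F (m + n) = F m \<circ> F n"
    and L: "L \<ge> 1"
    and lower: "\<bar>real_of_int m - real_of_int n\<bar> / L - L \<le> dist (F m bp) (F n bp)"
    and upper: "dist (F m bp) (F n bp) \<le> L * \<bar>real_of_int m - real_of_int n\<bar> + L"
    and C_pos: "C > 0" and contr: "contracting C (range (\<lambda>n. F n bp))"
begin

lemma dist_G: "g \<in> G \<Longrightarrow> dist (g x) (g y) = dist x y"
  using G_Isom by (auto simp: Isom_def)

lemma bij_G: "g \<in> G \<Longrightarrow> bij g"
  using G_Isom by (auto simp: Isom_def)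

lemma inv_G [simp]: "g \<in> G \<Longrightarrow> inv_into UNIV g (g x) = x" "g \<in> G \<Longrightarrow> g (inv_into UNIV g x) = x"
  by (simp_all add: bij_G bij_is_inj bij_is_surj surj_f_inv_f)

lemma dist_inv_G: "g \<in> G \<Longrightarrow> dist (inv_into UNIV g x) y = dist x (g y)"
  using dist_G[of g "inv_into UNIV g x" y] by simp

lemma id_mem: "id \<in> G"
  using F_mem[of 0] by (simp add: F_0)

lemma F_minus [simp]: "F n (F (- n) x) = x" "F (- n) (F n x) = x"
  using F_add[of n "- n"] F_add[of "- n" n] by (auto simp: F_0 fun_eq_iff)

lemma F_app: "F (m + n) x = F m (F n x)"
  by (simp add: F_add)

text \<open>\<open>F n\<close> stands for the \<open>n\<close>-th power of the contracting element,
  so these are the translates of its orbit axis in the overview, indexed by the translating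
  element.\<close>

definition axis :: "('a \<Rightarrow> 'a) \<Rightarrow> 'a set" where
  "axis g = range (\<lambda>n. g (F n bp))"

lemma axis_image: "g ` axis h = axis (g \<circ> h)"
  by (auto simp: axis_def)

lemma mem_axis: "g bp \<in> axis g"
  by (auto simp: axis_def F_0 intro!: range_eqI[of _ _ 0])

lemma contracting_axis:
  assumes "g \<in> G" shows "contracting_subset C (axis g)"
proof
  have "contracting C (g ` range (\<lambda>n. F n bp))"
    by (rule contracting_isometry_image) (use assms in \<open>auto simp: dist_G bij_G bij_is_surj contr\<close>)
  then show "contracting C (axis g)" by (simp add: axis_def image_image)
qed (auto simp: geod axis_def C_pos)

sublocale A: contracting_subset C "axis id"
  by (rule contracting_axis) (rule id_mem)

lemma dist_axis_lower: "\<bar>real_of_int m - real_of_int n\<bar> \<le> L * (dist (F m bp) (F n bp) + L)"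
  using lower[of m n] L by (simp add: field_simps)

lemma commute_powers:
  assumes "g \<circ> F i = F j \<circ> g"
  shows "g \<circ> F (i * int m) = F (j * int m) \<circ> g"
proof (induction m)
  case 0
  then show ?case by (simp add: F_0)
next
  case (Suc m)
  have "g \<circ> F (i * int (Suc m)) = (g \<circ> F (i * int m)) \<circ> F i"
    using F_add[of "i * int m" i] by (simp add: distrib_left add.commute comp_assoc)
  also have "\<dots> = (F (j * int m) \<circ> g) \<circ> F i" by (simp only: Suc.IH)
  also have "\<dots> = F (j * int m) \<circ> (F j \<circ> g)" by (simp only: comp_assoc assms)
  also have "\<dots> = F (j * int (Suc m)) \<circ> g"
  proof -
    have "j * int (Suc m) = j * int m + j" by (simp add: algebra_simps)
    then show ?thesis by (simp only: F_add comp_assoc)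
  qed
  finally show ?case .
qed

lemma commute_powers_int:
  assumes "g \<circ> F i = F j \<circ> g"
  shows "g \<circ> F (i * m) = F (j * m) \<circ> g"
proof (cases "m \<ge> 0")
  case True
  then show ?thesis using commute_powers[OF assms, of "nat m"] by simp
next
  case False
  have "g \<circ> F (- i) = F (- j) \<circ> g"
  proof
    fix x
    have "F j (g (F (- i) x)) = g x"
      using fun_cong[OF assms, of "F (- i) x"] by simp
    then show "(g \<circ> F (- i)) x = (F (- j) \<circ> g) x" by (metis F_minus(2) comp_apply)
  qed
  from commute_powers[OF this, of "nat (- m)"] show ?thesis using False by simp
qed

text \<open>A long projection yields a long geodesic piece near both axes. Each of
  \<open>N + 1\<close> sample points on it gives an element
  \<open>F (- n) \<circ> g \<circ> F m\<close> moving \<open>bp\<close> by at most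
  \<open>100 * C\<close>. There are only \<open>N\<close> such elements, so two of them coincide,
  and this equation is the asserted relation.\<close>

lemma projection_dichotomy:
  obtains \<theta> M where "\<And>g x y a b. \<lbrakk>g \<in> G; x \<in> axis g; y \<in> axis g;
    a \<in> nearest_points (axis id) x; b \<in> nearest_points (axis id) y; dist a b > \<theta>\<rbrakk> \<Longrightarrow>
    \<exists>i j. i \<noteq> 0 \<and> j \<noteq> 0 \<and> \<bar>real_of_int i\<bar> \<le> M \<and> g \<circ> F i = F j \<circ> g"
proof -
  define \<Phi> where "\<Phi> = {g \<in> G. dist bp (g bp) \<le> 100 * C}"
  define N where "N = card \<Phi>"
  \<comment> \<open>\<open>20 * C\<close> pays for passing from \<open>a\<close> and
    \<open>b\<close> to the geodesic, the middle term for the \<open>N\<close> gaps between samples,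
    and \<open>8 * C\<close> for \<open>geodesic_meets_projections\<close>.\<close>
  define \<theta> where "\<theta> = 20 * C + real N * (200 * C) + 8 * C"
  define M where "M = L * (real N * (200 * C) + 80 * C + L)"
  have "\<exists>i j. i \<noteq> 0 \<and> j \<noteq> 0 \<and> \<bar>real_of_int i\<bar> \<le> M \<and> g \<circ> F i = F j \<circ> g"
    if g: "g \<in> G" and x: "x \<in> axis g" and y: "y \<in> axis g"
      and a: "a \<in> nearest_points (axis id) x" and b: "b \<in> nearest_points (axis id) y"
      and ab: "dist a b > \<theta>" for g x y a b
  proof -
    interpret gA: contracting_subset C "axis g" by (rule contracting_axis[OF g])
    obtain S where "geodesic_segment S x y" using geod by (auto simp: geodesic_space_def)
    then obtain \<gamma> where \<gamma>: "\<gamma> 0 = x" "\<gamma> (dist x y) = y"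
      "\<And>s t. \<lbrakk>0 \<le> s; s \<le> dist x y; 0 \<le> t; t \<le> dist x y\<rbrakk> \<Longrightarrow> dist (\<gamma> s) (\<gamma> t) = \<bar>s - t\<bar>"
      by (elim geodesic_segmentE) metis
    have ab': "dist a b > 8 * C" 
    proof -
      have "real N * (200 * C) \<ge> 0" using C_pos by simp
      then show ?thesis using ab C_pos unfolding \<theta>_def by linarith
    qed
    obtain u v where uv: "0 \<le> u" "u \<le> v" "v \<le> dist x y"
      "dist (\<gamma> u) a \<le> 10 * C" "dist (\<gamma> v) b \<le> 10 * C"
      by (rule A.geodesic_meets_projections[where T="dist x y" and \<gamma>=\<gamma> and a=a and b=b])
        (use a b ab' \<gamma> in auto)
    have d: "dist (\<gamma> u) (\<gamma> v) = v - u" using \<gamma>(3)[of u v] uv by auto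
    have vu: "v - u \<ge> real N * (200 * C)"
      using ab uv d dist_triangle[of a b "\<gamma> u"] dist_triangle[of "\<gamma> u" b "\<gamma> v"] C_pos
      by (simp add: \<theta>_def dist_commute)
    have near: "\<exists>m n. dist (\<gamma> w) (g (F m bp)) \<le> 40 * C \<and> dist (\<gamma> w) (F n bp) \<le> 60 * C"
      if w: "u \<le> w" "w \<le> v" for w
    proof -
      have "dist (\<gamma> 0) (\<gamma> w) + dist (\<gamma> w) (\<gamma> (dist x y)) = dist x y"
        using \<gamma>(3)[of 0 w] \<gamma>(3)[of w "dist x y"] uv w by auto
      then have "infdist (\<gamma> w) (axis g) \<le> 2 * 0 + 40 * C"
        using x y \<gamma>(1,2) by (intro gA.between_close_points[of x _ y]) auto
      moreover obtain p where p: "p \<in> nearest_points (axis g) (\<gamma> w)" by (rule gA.nearest_pointE)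
      moreover have aA: "a \<in> axis id" "b \<in> axis id" using A.nearest_pointD a b by auto
      have "dist (\<gamma> u) (\<gamma> w) + dist (\<gamma> w) (\<gamma> v) = dist (\<gamma> u) (\<gamma> v)"
        using \<gamma>(3)[of u w] \<gamma>(3)[of w v] d uv w by auto
      then have "infdist (\<gamma> w) (axis id) \<le> 2 * (10 * C) + 40 * C"
        using infdist_le[OF aA(1), of "\<gamma> u"] infdist_le[OF aA(2), of "\<gamma> v"] uv
        by (intro A.between_close_points[of "\<gamma> u" _ "\<gamma> v"]) auto
      moreover obtain q where q: "q \<in> nearest_points (axis id) (\<gamma> w)" by (rule A.nearest_pointE)
      ultimately have "dist (\<gamma> w) p \<le> 40 * C" "dist (\<gamma> w) q \<le> 60 * C"
        using gA.nearest_pointD[OF p] A.nearest_pointD[OF q] by simp_all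
      moreover obtain m n where "p = g (F m bp)" "q = F n bp"
        using gA.nearest_pointD[OF p] A.nearest_pointD[OF q] by (auto simp: axis_def)
      ultimately show ?thesis by blast
    qed
    \<comment> \<open>Samples are within \<open>40 * C\<close> and \<open>60 * C\<close> of the two
      axes, so a spacing of \<open>200 * C\<close> forces both pairs of exponents at distinct
      samples to be distinct.\<close>
    define w where "w t = u + real t * (200 * C)" for t :: nat
    have w: "u \<le> w t" "w t \<le> v" if "t \<le> N" for t
    proof -
      have "real t * (200 * C) \<le> real N * (200 * C)" using that C_pos by (intro mult_right_mono) auto
      then show "w t \<le> v" using vu unfolding w_def by linarith
      show "u \<le> w t" using C_pos by (simp add: w_def)
    qed
    have "\<forall>t\<in>{..N}. \<exists>m n. dist (\<gamma> (w t)) (g (F m bp)) \<le> 40 * C \<and> dist (\<gamma> (w t)) (F n bp) \<le> 60 * C"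
      using near w by auto
    then obtain m n where mn: "\<And>t. t \<le> N \<Longrightarrow> dist (\<gamma> (w t)) (g (F (m t) bp)) \<le> 40 * C"
      "\<And>t. t \<le> N \<Longrightarrow> dist (\<gamma> (w t)) (F (n t) bp) \<le> 60 * C"
      by (metis atMost_iff)
    define \<phi> where "\<phi> t = F (- n t) \<circ> g \<circ> F (m t)" for t
    have "\<phi> t \<in> \<Phi>" if "t \<le> N" for t
    proof -
      have "dist bp (\<phi> t bp) = dist (F (n t) bp) (g (F (m t) bp))"
        using dist_G[OF F_mem[of "n t"], of bp "\<phi> t bp"] by (simp add: \<phi>_def)
      also have "\<dots> \<le> 100 * C"
        using mn[OF that] dist_triangle[of "F (n t) bp" "g (F (m t) bp)" "\<gamma> (w t)"] by (simp add: dist_commute)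
      finally show ?thesis using g by (auto simp: \<Phi>_def \<phi>_def comp_closed F_mem)
    qed
    then have "card (\<phi> ` {..N}) \<le> N"
      unfolding N_def by (intro card_mono) (auto simp: \<Phi>_def finite_ball)
    then have "\<not> inj_on \<phi> {..N}" by (intro pigeonhole) auto
    then obtain s t where st: "s \<le> N" "t \<le> N" "s \<noteq> t" "\<phi> s = \<phi> t" by (auto simp: inj_on_def)
    have "\<bar>w s - w t\<bar> = \<bar>real s - real t\<bar> * (200 * C)"
      using C_pos by (simp add: w_def left_diff_distrib[symmetric] abs_mult)
    moreover have "\<bar>real s - real t\<bar> \<ge> 1" using st by linarith
    moreover have "\<bar>real s - real t\<bar> \<le> real N" using st by linarith
    ultimately have wst: "\<bar>w s - w t\<bar> \<ge> 200 * C" "\<bar>w s - w t\<bar> \<le> real N * (200 * C)"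
      using C_pos mult_right_mono[of 1 "\<bar>real s - real t\<bar>" "200 * C"] by auto
    have dst: "dist (\<gamma> (w s)) (\<gamma> (w t)) = \<bar>w s - w t\<bar>"
      using \<gamma>(3)[of "w s" "w t"] w[OF st(1)] w[OF st(2)] uv by auto
    have dm: "dist (F (m s) bp) (F (m t) bp) = dist (g (F (m s) bp)) (g (F (m t) bp))"
      by (simp add: dist_G g)
    have mm: "dist (F (m s) bp) (F (m t) bp) \<le> real N * (200 * C) + 80 * C"
      unfolding dm using mn(1)[OF st(1)] mn(1)[OF st(2)] wst dst
        dist_triangle[of "g (F (m s) bp)" "g (F (m t) bp)" "\<gamma> (w s)"]
        dist_triangle[of "\<gamma> (w s)" "g (F (m t) bp)" "\<gamma> (w t)"] by (simp add: dist_commute)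
    have "m s \<noteq> m t"
    proof
      assume "m s = m t"
      then show False using mn(1)[OF st(1)] mn(1)[OF st(2)] wst dst C_pos
        dist_triangle2[of "\<gamma> (w s)" "\<gamma> (w t)" "g (F (m s) bp)"] by simp
    qed
    moreover have "n s \<noteq> n t"
    proof
      assume "n s = n t"
      then show False using mn(2)[OF st(1)] mn(2)[OF st(2)] wst dst C_pos
        dist_triangle2[of "\<gamma> (w s)" "\<gamma> (w t)" "F (n s) bp"] by simp
    qed
    moreover have "\<bar>real_of_int (m s - m t)\<bar> \<le> M"
    proof -
      have "\<bar>real_of_int (m s - m t)\<bar> \<le> L * (dist (F (m s) bp) (F (m t) bp) + L)"
        using dist_axis_lower[of "m s" "m t"] by simp
      also have "\<dots> \<le> M" unfolding M_def using mm L by (intro mult_left_mono) auto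
      finally show ?thesis .
    qed
    moreover have "g \<circ> F (m s - m t) = F (n s - n t) \<circ> g"
    proof
      fix x
      have "F (- n s) (g (F (m s) (F (- m t) x))) = F (- n t) (g (F (m t) (F (- m t) x)))"
        using fun_cong[OF st(4), of "F (- m t) x"] by (simp add: \<phi>_def)
      then have "F (- n s) (g (F (m s) (F (- m t) x))) = F (- n t) (g x)" by simp
      then have "F (n s) (F (- n s) (g (F (m s) (F (- m t) x)))) = F (n s) (F (- n t) (g x))" by simp
      then have "g (F (m s) (F (- m t) x)) = F (n s) (F (- n t) (g x))" by simp
      then show "(g \<circ> F (m s - m t)) x = (F (n s - n t) \<circ> g) x"
        using F_add[of "m s" "- m t"] F_add[of "n s" "- n t"] by simp
    qed
    ultimately show ?thesis by (intro exI[of _ "m s - m t"] exI[of _ "n s - n t"]) auto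
  qed
  then show ?thesis by (rule that)
qed

text \<open>A suitable power of \<open>F j\<close> moves \<open>g bp\<close> by a bounded distance, whereas it moves points far
  from the axis by at least about twice their distance to the axis.\<close>

lemma commensurating_displacement:
  obtains D where "\<And>g i j. \<lbrakk>g \<in> G; j \<noteq> 0; \<bar>real_of_int i\<bar> \<le> M; g \<circ> F i = F j \<circ> g\<rbrakk> \<Longrightarrow>
    infdist (g bp) (axis id) \<le> D"
proof -
  \<comment> \<open>As \<open>j\<close> is nonzero, \<open>k = j * int m\<close> has absolute value
    at least \<open>m\<close>. The lower quasi-isometry bound then makes \<open>F k\<close> move
    every axis point by more than \<open>8 * C\<close>, as \<open>projection_inequality\<close>
    requires.\<close>
  obtain m :: nat where m: "real m > L * (8 * C + L)" using reals_Archimedean2 by blast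
  have mp: "m > 0" using m L C_pos by (intro gr0I) (simp add: mult_less_0_iff)
  have "infdist (g bp) (axis id) \<le> L * (M * real m) + L + 40 * C"
    if g: "g \<in> G" and j: "j \<noteq> 0" and i: "\<bar>real_of_int i\<bar> \<le> M" and gF: "g \<circ> F i = F j \<circ> g" for g i j
  proof -
    define k where "k = j * int m"
    obtain a where a: "a \<in> nearest_points (axis id) (g bp)" by (rule A.nearest_pointE)
    have "F k ` axis id = (\<lambda>n. F n bp) ` range (\<lambda>n. k + n)"
      by (simp only: axis_def image_image F_app id_apply)
    also have "range (\<lambda>n. k + n) = UNIV" by (rule surj_plus)
    finally have "F k ` axis id = axis id" by (simp only: axis_def id_apply)
    then have "nearest_points (axis id) (F k (g bp)) = F k ` nearest_points (axis id) (g bp)"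
      using nearest_points_isometry[of "F k" "axis id" "g bp"] by (simp only: dist_G F_mem)
    then have b: "F k a \<in> nearest_points (axis id) (F k (g bp))" using a by blast
    obtain n where n: "a = F n bp" using A.nearest_pointD[OF a] by (auto simp: axis_def)
    have "real m \<le> \<bar>real_of_int (k + n) - real_of_int n\<bar>"
    proof -
      have "1 \<le> \<bar>real_of_int j\<bar>" using j by linarith
      then show ?thesis by (simp add: k_def abs_mult mult_le_cancel_right1)
    qed
    also have "\<dots> \<le> L * (dist (F (k + n) bp) (F n bp) + L)" by (rule dist_axis_lower)
    finally have "L * (8 * C + L) < L * (dist (F k a) a + L)" using m by (simp add: n F_app)
    then have "dist a (F k a) > 8 * C" using L by (simp add: dist_commute)
    from A.projection_inequality[OF a b this]
    have 1: "infdist (g bp) (axis id) \<le> dist (g bp) (F k (g bp)) + 40 * C"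
      using A.nearest_pointD[OF a] zero_le_dist[of a "F k a"] zero_le_dist[of "F k a" "F k (g bp)"]
      by linarith
    \<comment> \<open>The relation turns the displacement of \<open>g bp\<close> under
      \<open>F k\<close> into that of \<open>bp\<close> under \<open>F (i * int m)\<close>, which
      \<open>M\<close> controls.\<close>
    have "F k (g bp) = g (F (i * int m) bp)"
      using fun_cong[OF commute_powers[OF gF, of m], of bp] by (simp add: k_def)
    then have "dist (g bp) (F k (g bp)) = dist (F 0 bp) (F (i * int m) bp)"
      by (simp add: dist_G g F_0)
    also have "\<dots> \<le> L * \<bar>real_of_int 0 - real_of_int (i * int m)\<bar> + L" by (rule upper)
    also have "\<dots> \<le> L * (M * real m) + L"
      using i L by (simp add: abs_mult mult_right_mono)
    finally show ?thesis using 1 by simp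
  qed
  then show ?thesis by (rule that)
qed

text \<open>With \<open>n = j * m + r\<close>, the isometry \<open>F (j * m)\<close> takes
  \<open>F r bp\<close> to \<open>F n bp\<close> and \<open>g bp\<close> to a point of
  \<open>axis g\<close>. Only the finitely many remainders \<open>r\<close> matter for the
  distance.\<close>

lemma axis_near_commensurating:
  assumes g: "g \<in> G" and j: "j \<noteq> 0" and gF: "g \<circ> F i = F j \<circ> g"
  obtains c where "\<And>x. x \<in> axis id \<Longrightarrow> \<exists>y\<in>axis g. dist x y \<le> c"
proof -
  define c where "c = (\<Sum>r\<in>{0..<\<bar>j\<bar>}. dist (F r bp) (g bp))"
  have "\<exists>y\<in>axis g. dist x y \<le> c" if x: "x \<in> axis id" for x
  proof -
    obtain n where n: "x = F n bp" using x by (auto simp: axis_def)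
    \<comment> \<open>Dividing by the absolute value and putting the sign into \<open>m\<close>
      keeps the remainder nonnegative when \<open>j\<close> is negative.\<close>
    define m r where "m = sgn j * (n div \<bar>j\<bar>)" and "r = n mod \<bar>j\<bar>"
    have "j * m = \<bar>j\<bar> * (n div \<bar>j\<bar>)" by (simp add: m_def abs_sgn mult.assoc[symmetric])
    then have nm: "n = j * m + r" by (simp add: r_def)
    have r: "r \<in> {0..<\<bar>j\<bar>}" using j by (auto simp: r_def)
    have "F (j * m) (g bp) = g (F (i * m) bp)"
      using fun_cong[OF commute_powers_int[OF gF, of m], of bp] by simp
    then have "F (j * m) (g bp) \<in> axis g" by (auto simp: axis_def)
    moreover have "dist x (F (j * m) (g bp)) = dist (F r bp) (g bp)"
      unfolding n nm F_app by (simp add: dist_G F_mem)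
    moreover have "dist (F r bp) (g bp) \<le> c"
      unfolding c_def by (rule member_le_sum[OF r]) auto
    ultimately show ?thesis by (intro bexI[of _ "F (j * m) (g bp)"]) simp_all
  qed
  then show ?thesis by (rule that)
qed

end

section \<open>A common axis for finitely many subgroups\<close>

lemma projects_boundedly_Un:
  "projects_boundedly S (Y \<union> Y') \<longleftrightarrow> projects_boundedly S Y \<and> projects_boundedly S Y'"
  by (simp add: projects_boundedly_def UN_Un)

context orbit_axis
begin

text \<open>The inverse of \<open>g\<close> moves \<open>axis g\<close> to \<open>axis id\<close>,
  where \<open>projection_dichotomy\<close> applies; \<open>axis_near_commensurating\<close> turns
  the algebraic alternative into a geometric one. The constant is the same for all pairs.\<close>

lemma axis_dichotomy:
  obtains \<theta> where "\<And>g h. \<lbrakk>g \<in> G; h \<in> G\<rbrakk> \<Longrightarrow>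
    (\<forall>x\<in>axis h. \<forall>y\<in>axis h. \<forall>a\<in>nearest_points (axis g) x. \<forall>b\<in>nearest_points (axis g) y. dist a b \<le> \<theta>) \<or>
    (\<exists>c. \<forall>x\<in>axis g. \<exists>y\<in>axis h. dist x y \<le> c)"
proof -
  obtain \<theta> M where dich: "\<And>g x y a b. \<lbrakk>g \<in> G; x \<in> axis g; y \<in> axis g;
    a \<in> nearest_points (axis id) x; b \<in> nearest_points (axis id) y; dist a b > \<theta>\<rbrakk> \<Longrightarrow>
    \<exists>i j. i \<noteq> 0 \<and> j \<noteq> 0 \<and> \<bar>real_of_int i\<bar> \<le> M \<and> g \<circ> F i = F j \<circ> g"
    by (fact projection_dichotomy)
  have "\<exists>c. \<forall>x\<in>axis g. \<exists>y\<in>axis h. dist x y \<le> c"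
    if g: "g \<in> G" and h: "h \<in> G" and x: "x \<in> axis h" and y: "y \<in> axis h"
      and a: "a \<in> nearest_points (axis g) x" and b: "b \<in> nearest_points (axis g) y"
      and ab: "dist a b > \<theta>" for g h x y a b
  proof -
    define k where "k = inv_into UNIV g"
    have k: "k \<in> G" "\<And>x. k (g x) = x" "\<And>x. g (k x) = x" using g inv_closed by (auto simp: k_def)
    have kg: "k \<circ> g = id" "g \<circ> k = id" using k by auto
    have kA: "k ` axis h = axis (k \<circ> h)" "k ` axis g = axis id"
      by (simp_all add: axis_image kg)
    have np: "k ` nearest_points (axis g) z = nearest_points (axis id) (k z)" for z
      using nearest_points_isometry[of k "axis g" z] k(1) by (simp add: dist_G kA)
    have kh: "k \<circ> h \<in> G" using k h comp_closed by blast
    have kxy: "k x \<in> axis (k \<circ> h)" "k y \<in> axis (k \<circ> h)" using x y kA(1) by blast+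
    have kab: "k a \<in> nearest_points (axis id) (k x)" "k b \<in> nearest_points (axis id) (k y)"
      using a b unfolding np[symmetric] by blast+
    have "dist (k a) (k b) > \<theta>" using ab by (simp add: dist_G k)
    from dich[OF kh kxy kab this]
    obtain i j where ij: "j \<noteq> 0" "(k \<circ> h) \<circ> F i = F j \<circ> (k \<circ> h)" by blast
    obtain c where c: "\<And>x. x \<in> axis id \<Longrightarrow> \<exists>y\<in>axis (k \<circ> h). dist x y \<le> c"
      by (fact axis_near_commensurating[OF kh ij])
    have "\<exists>y\<in>axis h. dist z y \<le> c" if z: "z \<in> axis g" for z
    proof -
      have "k z \<in> axis id" using z kA by blast
      then obtain y where y: "y \<in> axis (k \<circ> h)" "dist (k z) y \<le> c" using c by blast
      then obtain y' where "y' \<in> axis h" "y = k y'" using kA(1) by blast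
      then show ?thesis using y by (auto simp: dist_G k)
    qed
    then show ?thesis by blast
  qed
  then have "(\<forall>x\<in>axis h. \<forall>y\<in>axis h. \<forall>a\<in>nearest_points (axis g) x. \<forall>b\<in>nearest_points (axis g) y. dist a b \<le> \<theta>) \<or>
    (\<exists>c. \<forall>x\<in>axis g. \<exists>y\<in>axis h. dist x y \<le> c)" if "g \<in> G" "h \<in> G" for g h
    using that by (meson not_le)
  then show ?thesis by (rule that)
qed

text \<open>An element taking \<open>bp\<close> farther from the axis than
  \<open>commensurating_displacement\<close> allows cannot satisfy the relation in
  \<open>projection_dichotomy\<close>, so its axis has small projection.\<close>

lemma independent_element:
  assumes spread: "\<And>D. \<exists>k\<in>G. infdist (k bp) (axis id) > D"
  obtains k \<theta> where "k \<in> G" "\<And>x y a b. \<lbrakk>x \<in> axis k; y \<in> axis k; a \<in> nearest_points (axis id) x;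
    b \<in> nearest_points (axis id) y\<rbrakk> \<Longrightarrow> dist a b \<le> \<theta>"
proof -
  obtain \<theta> M where dich: "\<And>g x y a b. \<lbrakk>g \<in> G; x \<in> axis g; y \<in> axis g;
    a \<in> nearest_points (axis id) x; b \<in> nearest_points (axis id) y; dist a b > \<theta>\<rbrakk> \<Longrightarrow>
    \<exists>i j. i \<noteq> 0 \<and> j \<noteq> 0 \<and> \<bar>real_of_int i\<bar> \<le> M \<and> g \<circ> F i = F j \<circ> g"
    by (fact projection_dichotomy)
  obtain D where D: "\<And>g i j. \<lbrakk>g \<in> G; j \<noteq> 0; \<bar>real_of_int i\<bar> \<le> M; g \<circ> F i = F j \<circ> g\<rbrakk> \<Longrightarrow>
    infdist (g bp) (axis id) \<le> D"
    by (fact commensurating_displacement)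
  obtain k where k: "k \<in> G" "infdist (k bp) (axis id) > D" using spread by blast
  show ?thesis
  proof (rule that[OF k(1)])
    fix x y a b
    assume xy: "x \<in> axis k" "y \<in> axis k" "a \<in> nearest_points (axis id) x" "b \<in> nearest_points (axis id) y"
    show "dist a b \<le> \<theta>"
    proof (rule ccontr)
      assume "\<not> dist a b \<le> \<theta>"
      then obtain i j where "j \<noteq> 0" "\<bar>real_of_int i\<bar> \<le> M" "k \<circ> F i = F j \<circ> k"
        using dich[OF k(1) xy] by (meson not_le)
      from D[OF k(1) this] show False using k(2) by linarith
    qed
  qed
qed

lemma infdist_axis:
  assumes "g \<in> G"
  shows "infdist bp (axis (g \<circ> h)) = infdist (inv_into UNIV g bp) (axis h)"
proof -
  have "axis (g \<circ> h) = g ` axis h" by (simp add: axis_image)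
  then have "infdist (g (inv_into UNIV g bp)) (axis (g \<circ> h)) = infdist (inv_into UNIV g bp) (axis h)"
    by (simp only: infdist_def image_image dist_G[OF assms]) (simp add: image_is_empty)
  then show ?thesis using assms by simp
qed

text \<open>Seen from \<open>x\<close>, the preimage of \<open>bp\<close> under \<open>g\<close>,
  the hypothesis says that \<open>x\<close> is near both \<open>axis id\<close> and
  \<open>axis k\<close>. As \<open>axis k\<close> has small projection to \<open>axis id\<close>,
  such points stay near \<open>bp\<close>. Hence along a sequence with \<open>g bp\<close> escaping,
  the farther of the two axes escapes.\<close>

lemma independent_axes_diverge:
  assumes spread: "\<And>D. \<exists>k\<in>G. infdist (k bp) (axis id) > D"
  obtains k where "k \<in> G" "\<And>R. \<exists>T. \<forall>g\<in>G. infdist bp (axis g) \<le> R \<and> infdist bp (axis (g \<circ> k)) \<le> R \<longrightarrow>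
    dist bp (g bp) \<le> T"
proof -
  obtain k \<theta> where k: "k \<in> G" and \<theta>: "\<And>x y a b. \<lbrakk>x \<in> axis k; y \<in> axis k;
    a \<in> nearest_points (axis id) x; b \<in> nearest_points (axis id) y\<rbrakk> \<Longrightarrow> dist a b \<le> \<theta>"
    by (fact independent_element[OF spread])
  interpret kA: contracting_subset C "axis k" by (rule contracting_axis[OF k])
  have "dist bp (g bp) \<le> 2 * dist bp (k bp) + \<theta> + 3 * R"
    if g: "g \<in> G" and R1: "infdist bp (axis g) \<le> R" and R2: "infdist bp (axis (g \<circ> k)) \<le> R" for g R
  proof -
    define x where "x = inv_into UNIV g bp"
    have x: "infdist x (axis id) \<le> R" "infdist x (axis k) \<le> R" "dist bp x = dist bp (g bp)"
      using R1 R2 infdist_axis[OF g, of id] infdist_axis[OF g, of k] dist_inv_G[OF g, of bp bp]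
      by (simp_all add: x_def dist_commute)
    obtain a where a: "a \<in> nearest_points (axis id) x" by (rule A.nearest_pointE)
    obtain b where b: "b \<in> nearest_points (axis k) x" by (rule kA.nearest_pointE)
    obtain a' where a': "a' \<in> nearest_points (axis id) b" by (rule A.nearest_pointE)
    obtain c where c: "c \<in> nearest_points (axis id) (k bp)" by (rule A.nearest_pointE)
    have "bp \<in> axis id" using mem_axis[of id] by simp
    then have 1: "dist (k bp) c \<le> dist (k bp) bp"
      using A.nearest_pointD[OF c] infdist_le[of bp "axis id" "k bp"] by simp
    have 2: "dist a' c \<le> \<theta>"
      using \<theta>[of b "k bp" a' c] a' c kA.nearest_pointD[OF b] mem_axis[of k] by blast
    have 3: "dist b a' \<le> dist b a"
      using A.nearest_pointD[OF a'] A.nearest_pointD[OF a] infdist_le[of a "axis id" b] by simp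
    have 4: "dist x a \<le> R" "dist x b \<le> R"
      using A.nearest_pointD[OF a] kA.nearest_pointD[OF b] x by simp_all
    show ?thesis
      using 1 2 3 4 x(3) dist_triangle[of bp x "k bp"] dist_triangle[of "k bp" x c] dist_triangle[of c x a']
        dist_triangle[of a' x b] dist_triangle[of b a x] by (simp add: dist_commute)
  qed
  then show ?thesis using k by (intro that[of k]) blast+
qed

section \<open>From one good translate per subgroup to a common one\<close>

definition orbit_of :: "('a \<Rightarrow> 'a) set \<Rightarrow> 'a set" where
  "orbit_of Z = (\<lambda>z. z bp) ` Z"

text \<open>The closure condition is the subgroup criterion, so \<open>z\<close> preserves the
  orbit. Exchanging \<open>bp\<close> for \<open>z bp\<close> costs \<open>d\<close> twice in the
  slack and once in the bound.\<close>

lemma avoids_translate: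
  assumes ZG: "Z \<subseteq> G" and Z: "\<And>z w. \<lbrakk>z \<in> Z; w \<in> Z\<rbrakk> \<Longrightarrow> inv_into UNIV z \<circ> w \<in> Z"
    and z: "z \<in> Z" and av: "avoids bp S (orbit_of Z)"
  shows "avoids bp (z ` S) (orbit_of Z)"
  unfolding avoids_def
proof
  fix E
  define d where "d = dist bp (z bp)"
  have zG: "z \<in> G" using z ZG by blast
  obtain R where R: "\<And>b y. \<lbrakk>b \<in> S; y \<in> orbit_of Z; dist bp b + dist b y \<le> dist bp y + (E + 2 * d)\<rbrakk> \<Longrightarrow> dist bp b \<le> R"
    using av unfolding avoids_def by meson
  have "dist bp b \<le> R + d"
    if b: "b \<in> z ` S" and y: "y \<in> orbit_of Z" and E: "dist bp b + dist b y \<le> dist bp y + E" for b y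
  proof -
    obtain b' where b': "b' \<in> S" "b = z b'" using b by blast
    obtain w where w: "w \<in> Z" "y = w bp" using y by (auto simp: orbit_of_def)
    define y' where "y' = inv_into UNIV z y"
    have y': "y' \<in> orbit_of Z" "y = z y'"
      using Z[OF z w(1)] w(2) zG by (auto simp: y'_def orbit_of_def intro!: image_eqI[of _ _ "inv_into UNIV z \<circ> w"])
    have "dist bp b' = dist (z bp) b" "dist b' y' = dist b y" "dist bp y' = dist (z bp) y"
      by (simp_all add: b' y' dist_G zG)
    then have "dist bp b' \<le> R"
      using E dist_triangle[of "z bp" b bp] dist_triangle[of bp y "z bp"]
      by (intro R[OF b'(1) y'(1)]) (simp add: d_def dist_commute)
    then show ?thesis
      using \<open>dist bp b' = dist (z bp) b\<close> dist_triangle[of bp b "z bp"] by (simp add: d_def)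
  qed
  then show "\<exists>R. \<forall>b\<in>z ` S. \<forall>y\<in>orbit_of Z. dist bp b + dist b y \<le> dist bp y + E \<longrightarrow> dist bp b \<le> R"
    by blast
qed

text \<open>If \<open>h1\<close> fails for \<open>Z\<close>, some \<open>z \<in> Z\<close> carries \<open>bp\<close> far along the axis of \<open>h1\<close>; then \<open>z \<circ> h2\<close> works,
  since its axis lies beyond that of \<open>h1\<close> as seen from \<open>Y\<close>.\<close>

lemma common_axis_step:
  assumes h1: "h1 \<in> G" and Y: "projects_boundedly (axis h1) Y"
    and ZG: "Z \<subseteq> G" and Z: "\<And>z w. \<lbrakk>z \<in> Z; w \<in> Z\<rbrakk> \<Longrightarrow> inv_into UNIV z \<circ> w \<in> Z"
    and h2: "h2 \<in> G" and Zh2: "projects_boundedly (axis h2) (orbit_of Z)"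
  shows "\<exists>h\<in>G. projects_boundedly (axis h) (Y \<union> orbit_of Z)"
proof (cases "projects_boundedly (axis h1) (orbit_of Z)")
  case True
  then show ?thesis using h1 Y by (auto simp: projects_boundedly_Un)
next
  case False
  interpret h1A: contracting_subset C "axis h1" by (rule contracting_axis[OF h1])
  obtain \<theta> where \<theta>: "\<And>g h. \<lbrakk>g \<in> G; h \<in> G\<rbrakk> \<Longrightarrow>
    (\<forall>x\<in>axis h. \<forall>y\<in>axis h. \<forall>a\<in>nearest_points (axis g) x. \<forall>b\<in>nearest_points (axis g) y. dist a b \<le> \<theta>) \<or>
    (\<exists>c. \<forall>x\<in>axis g. \<exists>y\<in>axis h. dist x y \<le> c)" by (fact axis_dichotomy)
  obtain \<rho> where \<rho>: "\<And>T. \<lbrakk>contracting_subset C T;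
    \<And>b c. b \<in> T \<Longrightarrow> c \<in> nearest_points (axis h1) b \<Longrightarrow> dist bp c \<ge> \<rho>\<rbrakk> \<Longrightarrow> projects_boundedly T Y"
    by (fact h1A.projects_boundedly_beyond[OF Y])
  \<comment> \<open>From \<open>a\<close>, the projection of \<open>h bp\<close> is reached at cost
    \<open>dist bp (h2 bp) + 40 * C\<close>, and from there the projection of any point of
    \<open>axis h\<close> at cost \<open>\<theta>\<close>.\<close>
  define \<rho>' where "\<rho>' = \<rho> + \<theta> + dist bp (h2 bp) + 40 * C"
  have "\<not> (\<forall>y\<in>orbit_of Z. \<forall>a\<in>nearest_points (axis h1) y. dist bp a \<le> \<rho>')"
    using False unfolding projects_boundedly_iff[of _ _ bp] by simp
  then obtain z a where z: "z \<in> Z" and a: "a \<in> nearest_points (axis h1) (z bp)" "dist bp a > \<rho>'"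
    unfolding orbit_of_def by (auto simp: not_le)
  have zG: "z \<in> G" using z ZG by blast
  define h where "h = z \<circ> h2"
  have h: "h \<in> G" using zG h2 comp_closed by (simp add: h_def)
  interpret h2A: contracting_subset C "axis h2" by (rule contracting_axis[OF h2])
  interpret hA: contracting_subset C "axis h" by (rule contracting_axis[OF h])
  have "avoids bp (axis h) (orbit_of Z)"
    using avoids_translate[OF ZG Z z] Zh2 h2A.projects_boundedly_iff_avoids[of _ bp]
    unfolding h_def axis_image[symmetric] by blast
  then have hZ: "projects_boundedly (axis h) (orbit_of Z)"
    by (simp add: hA.projects_boundedly_iff_avoids[of _ bp])
  have "\<not> avoids bp (axis h1) (orbit_of Z)"
    using False by (simp add: h1A.projects_boundedly_iff_avoids[of _ bp])
  \<comment> \<open>Otherwise \<open>axis h1\<close> would inherit from \<open>axis h\<close> that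
    it avoids the orbit of \<open>Z\<close>. The dichotomy therefore leaves only the alternative of
    small projection.\<close>
  then have "\<not> (\<exists>c. \<forall>x\<in>axis h1. \<exists>y\<in>axis h. dist x y \<le> c)"
    using avoids_near[OF \<open>avoids bp (axis h) (orbit_of Z)\<close>] by blast
  then have small: "dist x y \<le> \<theta>" if "b \<in> axis h" "c \<in> axis h" "x \<in> nearest_points (axis h1) b"
    "y \<in> nearest_points (axis h1) c" for b c x y
    using \<theta>[OF h1 h] that by blast
  have "dist bp c \<ge> \<rho>" if b: "b \<in> axis h" and c: "c \<in> nearest_points (axis h1) b" for b c
  proof -
    obtain e where e: "e \<in> nearest_points (axis h1) (h bp)" by (rule h1A.nearest_pointE)
    have "dist a e \<le> dist (z bp) (h bp) + 40 * C" by (rule h1A.projection_lipschitz[OF a(1) e])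
    moreover have "dist (z bp) (h bp) = dist bp (h2 bp)" by (simp add: h_def dist_G zG)
    moreover have "dist e c \<le> \<theta>" by (rule small[OF mem_axis b e c])
    ultimately show ?thesis
      using a(2) dist_triangle[of bp a c] dist_triangle[of c a e] by (simp add: \<rho>'_def dist_commute)
  qed
  then have "projects_boundedly (axis h) Y"
    by (intro \<rho> hA.contracting_subset_axioms) auto
  then show ?thesis using h hZ by (auto simp: projects_boundedly_Un)
qed

lemma common_axis:
  assumes "finite \<Z>"
    and "\<And>Z. Z \<in> \<Z> \<Longrightarrow> Z \<subseteq> G"
    and "\<And>Z z w. \<lbrakk>Z \<in> \<Z>; z \<in> Z; w \<in> Z\<rbrakk> \<Longrightarrow> inv_into UNIV z \<circ> w \<in> Z"
    and "\<And>Z. Z \<in> \<Z> \<Longrightarrow> \<exists>h\<in>G. projects_boundedly (axis h) (orbit_of Z)"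
  shows "\<exists>h\<in>G. projects_boundedly (axis h) (\<Union>Z\<in>\<Z>. orbit_of Z)"
  using assms
proof (induction \<Z> rule: finite_induct)
  case empty
  then show ?case using id_mem by (auto simp: projects_boundedly_def)
next
  case (insert Z \<Z>)
  have "\<exists>h\<in>G. projects_boundedly (axis h) (\<Union>Z\<in>\<Z>. orbit_of Z)"
  proof (rule insert.IH)
    show "inv_into UNIV z \<circ> w \<in> Z'" if "Z' \<in> \<Z>" "z \<in> Z'" "w \<in> Z'" for Z' z w
      using insert.prems(2)[of Z' z w] that by blast
  qed (use insert.prems(1,3) in blast)+
  then obtain h1 where h1: "h1 \<in> G" "projects_boundedly (axis h1) (\<Union>Z\<in>\<Z>. orbit_of Z)"
    by blast
  obtain h2 where h2: "h2 \<in> G" "projects_boundedly (axis h2) (orbit_of Z)"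
    using insert.prems(3) by blast
  have "\<exists>h\<in>G. projects_boundedly (axis h) ((\<Union>Z\<in>\<Z>. orbit_of Z) \<union> orbit_of Z)"
  proof (rule common_axis_step[OF h1 _ _ h2])
    show "Z \<subseteq> G" using insert.prems(1) by blast
    show "inv_into UNIV z \<circ> w \<in> Z" if "z \<in> Z" "w \<in> Z" for z w
      using insert.prems(2)[of Z z w] that by blast
  qed
  then show ?case by (simp add: Un_commute)
qed

text \<open>Points of \<open>Y\<close> project near \<open>bp\<close>, so a geodesic to them from a
  point projecting far from \<open>bp\<close> passes near \<open>bp\<close>. If \<open>x\<close>
  projects close to \<open>bp\<close>, the inverse of \<open>J\<close>, a translation along the
  axis, first moves its projection away.\<close>

lemma push_away:
  assumes h: "h \<in> G" and Y: "projects_boundedly (axis h) Y"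
  obtains J c where "J \<in> G" "\<And>x. \<exists>E\<in>{id, J}. \<forall>y\<in>Y.
    dist (inv_into UNIV E x) bp + dist bp y \<le> dist (inv_into UNIV E x) y + c"
proof -
  interpret hA: contracting_subset C "axis h" by (rule contracting_axis[OF h])
  obtain R where R: "\<And>y a. y \<in> Y \<Longrightarrow> a \<in> nearest_points (axis h) y \<Longrightarrow> dist bp a \<le> R"
    using Y unfolding projects_boundedly_iff[of _ _ bp] by blast
  define \<rho> where "\<rho> = \<bar>R\<bar> + 9 * C"
  define c where "c = 40 * C + 2 * \<bar>R\<bar>"
  have far: "dist x bp + dist bp y \<le> dist x y + c"
    if a: "a \<in> nearest_points (axis h) x" and a\<rho>: "dist bp a \<ge> \<rho>" and y: "y \<in> Y" for a x y
  proof -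
    obtain q where q: "q \<in> nearest_points (axis h) y" by (rule hA.nearest_pointE)
    have qR: "dist bp q \<le> R" by (rule R[OF y q])
    then have "dist a q > 8 * C"
      using a\<rho> C_pos dist_triangle[of bp a q] by (simp add: \<rho>_def dist_commute)
    from hA.projection_inequality[OF a q this] show ?thesis
      using qR dist_triangle[of x bp a] dist_triangle[of a bp q] dist_triangle[of bp y q]
      by (simp add: c_def dist_commute)
  qed
  define h' where "h' = inv_into UNIV h"
  have h': "h' \<in> G" "\<And>x. h' (h x) = x" "\<And>x. h (h' x) = x"
    using h inv_closed by (auto simp: h'_def)
  \<comment> \<open>The inverse \<open>K\<close> of \<open>J\<close> then shifts axis points by more
    than \<open>2 * \<rho>\<close>, so a projection within \<open>\<rho>\<close> of
    \<open>bp\<close> is moved out of this range.\<close>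
  obtain n :: nat where n: "real n > L * (2 * \<rho> + L)" using reals_Archimedean2 by blast
  define J where "J = h \<circ> F (int n) \<circ> h'"
  define K where "K = h \<circ> F (- int n) \<circ> h'"
  have J: "J \<in> G" and K: "K \<in> G" using h h' F_mem comp_closed by (auto simp: J_def K_def)
  have invJ: "inv_into UNIV J = K"
    by (rule inv_equality) (auto simp: J_def K_def h')
  have "\<exists>E\<in>{id, J}. \<forall>y\<in>Y. dist (inv_into UNIV E x) bp + dist bp y \<le> dist (inv_into UNIV E x) y + c" for x
  proof -
    obtain a where a: "a \<in> nearest_points (axis h) x" by (rule hA.nearest_pointE)
    show ?thesis
    proof (cases "dist bp a \<ge> \<rho>")
      case True
      then show ?thesis using far[OF a] by (intro bexI[of _ id]) auto
    next
      case False
      have "K ` axis h = h ` (\<lambda>m. F m bp) ` range (\<lambda>m. - int n + m)"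
        by (simp only: axis_def K_def image_image F_app comp_apply h')
      also have "range (\<lambda>m. - int n + m) = UNIV" by (rule surj_plus)
      finally have "K ` axis h = axis h" by (simp only: axis_def image_image)
      then have "nearest_points (axis h) (K x) = K ` nearest_points (axis h) x"
        using nearest_points_isometry[of K "axis h" x] by (simp only: dist_G K)
      then have Ka: "K a \<in> nearest_points (axis h) (K x)" using a by blast
      obtain m where m: "a = h (F m bp)" using hA.nearest_pointD[OF a] by (auto simp: axis_def)
      have "real n = \<bar>real_of_int m - real_of_int (- int n + m)\<bar>" by simp
      also have "\<dots> \<le> L * (dist (F m bp) (F (- int n + m) bp) + L)" by (rule dist_axis_lower)
      also have "dist (F m bp) (F (- int n + m) bp) = dist a (K a)"
        unfolding m K_def F_app by (simp add: h' dist_G h)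
      finally have "L * (2 * \<rho> + L) < L * (dist a (K a) + L)" using n by linarith
      then have "2 * \<rho> < dist a (K a)" using L by simp
      then have "dist bp (K a) \<ge> \<rho>" using False dist_triangle[of a "K a" bp] by (simp add: dist_commute)
      then show ?thesis using far[OF Ka] by (intro bexI[of _ J]) (auto simp: invJ)
    qed
  qed
  then show ?thesis by (rule that[OF J])
qed

end

section \<open>The convergence boundary\<close>

text \<open>The sequences need not converge, so their limits are compared along common subsequences.
  Since \<open>R\<close> will be a relation on the boundary, limits compared in this way lie
  there.\<close>

definition asymptotic :: "('a \<Rightarrow> 'b::topological_space) \<Rightarrow> ('b \<times> 'b) set \<Rightarrow> (nat \<Rightarrow> 'a) \<Rightarrow> (nat \<Rightarrow> 'a) \<Rightarrow> bool" where
  "asymptotic emb R u v \<longleftrightarrow> (\<forall>r l m. strict_mono (r::nat \<Rightarrow> nat) \<and>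
    (\<lambda>n. emb (u (r n))) \<longlonglongrightarrow> l \<and> (\<lambda>n. emb (v (r n))) \<longlonglongrightarrow> m \<longrightarrow> (l, m) \<in> R)"

lemma asymptotic_trans:
  fixes emb :: "'a \<Rightarrow> 'b::metric_space"
  assumes "compact (UNIV :: 'b set)" and "trans R"
    and uv: "asymptotic emb R u v" and vw: "asymptotic emb R v w"
  shows "asymptotic emb R u w"
  unfolding asymptotic_def
proof (intro allI impI, elim conjE)
  fix r :: "nat \<Rightarrow> nat" and l m
  assume r: "strict_mono r" and l: "(\<lambda>n. emb (u (r n))) \<longlonglongrightarrow> l" and m: "(\<lambda>n. emb (w (r n))) \<longlonglongrightarrow> m"
  \<comment> \<open>Compactness gives the middle sequence a limit along a further subsequence; the
    outer limits \<open>l\<close> and \<open>m\<close> stay the same.\<close>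
  obtain k s where s: "strict_mono (s::nat \<Rightarrow> nat)" "((\<lambda>n. emb (v (r n))) \<circ> s) \<longlonglongrightarrow> k"
    using \<open>compact UNIV\<close> unfolding compact_def by (metis UNIV_I)
  have rs: "strict_mono (r \<circ> s)" using r s by (simp add: strict_mono_o)
  have "(\<lambda>n. emb (v ((r \<circ> s) n))) \<longlonglongrightarrow> k" using s(2) by (simp add: o_def)
  moreover have "(\<lambda>n. emb (u ((r \<circ> s) n))) \<longlonglongrightarrow> l"
    using LIMSEQ_subseq_LIMSEQ[OF l s(1)] by (simp add: o_def)
  moreover have "(\<lambda>n. emb (w ((r \<circ> s) n))) \<longlonglongrightarrow> m"
    using LIMSEQ_subseq_LIMSEQ[OF m s(1)] by (simp add: o_def)
  ultimately have "(l, k) \<in> R" "(k, m) \<in> R" using uv vw rs unfolding asymptotic_def by blast+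
  then show "(l, m) \<in> R" using \<open>trans R\<close> by (meson transD)
qed

text \<open>Condition B supplies a single class for the cones themselves, so it receives the limits
  of both sequences.\<close>

lemma asymptotic_cones:
  assumes B: "convergence_cond_B bp emb R" and R: "equiv X R"
    and S: "\<And>n. contracting C (S n)" "\<And>n. quasi_geodesic L (S n)" and esc: "escaping bp S"
    and uv: "\<And>n. u n \<in> cone_through p (S n)" "\<And>n. v n \<in> cone_through p (S n)"
  shows "asymptotic emb R u v"
  unfolding asymptotic_def
proof (intro allI impI, elim conjE)
  fix r :: "nat \<Rightarrow> nat" and l m
  assume r: "strict_mono r" and l: "(\<lambda>n. emb (u (r n))) \<longlonglongrightarrow> l" and m: "(\<lambda>n. emb (v (r n))) \<longlonglongrightarrow> m"
  have "escaping bp (\<lambda>n. S (r n))"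
    using filterlim_compose[OF esc[unfolded escaping_def] filterlim_subseq[OF r]]
    by (simp add: escaping_def)
  then obtain s \<xi> where s: "strict_mono (s::nat \<Rightarrow> nat)" and \<xi>: "\<And>y l. (\<forall>n. y n \<in> cone_through p (S (r (s n)))) \<Longrightarrow>
      (\<lambda>n. emb (y n)) \<longlonglongrightarrow> l \<Longrightarrow> l \<in> R `` {\<xi>}"
    using B[unfolded convergence_cond_B_def, rule_format, of C "\<lambda>n. S (r n)" L p] S by blast
  have "l \<in> R `` {\<xi>}"
    by (rule \<xi>[of "\<lambda>n. u (r (s n))"]) (use uv LIMSEQ_subseq_LIMSEQ[OF l s] in \<open>auto simp: o_def\<close>)
  moreover have "m \<in> R `` {\<xi>}"
    by (rule \<xi>[of "\<lambda>n. v (r (s n))"]) (use uv LIMSEQ_subseq_LIMSEQ[OF m s] in \<open>auto simp: o_def\<close>)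
  ultimately show "(l, m) \<in> R" using R by (meson Image_singleton_iff equivE symE transE)
qed

text \<open>Two-point sets of bounded diameter are uniformly contracting quasi-geodesics, so
  condition B applies to them. This is what makes sequences at bounded distance asymptotic.\<close>

lemma contracting_doubleton:
  assumes "dist u v \<le> D"
  shows "contracting D {u, v}"
proof -
  have "0 \<le> D" using assms zero_le_dist[of u v] by linarith
  have "diameter (nearest_points {u, v} x \<union> nearest_points {u, v} y) \<le> D" for x y
  proof -
    define W where "W = nearest_points {u, v} x \<union> nearest_points {u, v} y"
    have W: "W \<subseteq> {u, v}" by (auto simp: W_def nearest_points_def)
    have "dist a b \<le> D" if "a \<in> W" "b \<in> W" for a b
    proof -
      have "a \<in> {u, v}" "b \<in> {u, v}" using that W by blast+
      then show ?thesis using assms \<open>0 \<le> D\<close> by (auto simp: dist_commute)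
    qed
    then have "(SUP (a, b)\<in>W \<times> W. dist a b) \<le> D" if "W \<noteq> {}"
      using that by (intro cSUP_least) auto
    then show ?thesis using \<open>0 \<le> D\<close> unfolding W_def[symmetric] by (simp add: diameter_def)
  qed
  then show ?thesis by (simp add: contracting_def)
qed

lemma quasi_geodesic_doubleton:
  assumes "dist u v \<le> D"
  shows "quasi_geodesic (max 1 D) {u, v}"
proof -
  define f where "f t = (if t = (0::real) then u else v)" for t
  have "qi_embedding_on (max 1 D) {0..1} f"
    unfolding qi_embedding_on_def
  proof (intro conjI ballI)
    fix s t :: real assume st: "s \<in> {0..1}" "t \<in> {0..1}"
    have "\<bar>s - t\<bar> / max 1 D \<le> 1" using st by (simp add: divide_le_eq) linarith
    then show "\<bar>s - t\<bar> / max 1 D - max 1 D \<le> dist (f s) (f t)"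
      using zero_le_dist[of "f s" "f t"] by linarith
    have "dist (f s) (f t) \<le> max 1 D" using assms by (auto simp: f_def dist_commute)
    moreover have "0 \<le> max 1 D * \<bar>s - t\<bar>" by simp
    ultimately show "dist (f s) (f t) \<le> max 1 D * \<bar>s - t\<bar> + max 1 D" by linarith
  qed simp
  moreover have "f ` {0..1} \<subseteq> {u, v}" by (auto simp: f_def)
  moreover have "u = f 0" "v = f 1" by (auto simp: f_def)
  then have "{u, v} \<subseteq> f ` {0..1}" by auto
  ultimately show ?thesis
    unfolding quasi_geodesic_def
    by (intro exI[of _ "{0..1}"] exI[of _ f] conjI equalityI) (auto simp: is_interval_cc)
qed

lemma mem_cone_through:
  assumes "geodesic_space TYPE('a::metric_space)" "x \<in> S"
  shows "(x::'a) \<in> cone_through p S"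
proof -
  obtain T where T: "geodesic_segment T p x" using assms(1) by (auto simp: geodesic_space_def)
  then have "x \<in> T"
    by (rule geodesic_segmentE) (metis atLeastAtMost_iff imageI order_refl zero_le_dist)
  then show ?thesis using T assms(2) by (auto simp: cone_through_def)
qed

lemma escaping_doubleton:
  assumes "\<And>n. dist (u n) (v n) \<le> D" and "filterlim (\<lambda>n. dist bp (u n)) at_top sequentially"
  shows "escaping bp (\<lambda>n. {u n, v n})"
proof -
  have le: "dist bp (u n) - \<bar>D\<bar> \<le> infdist bp {u n, v n}" for n
    using assms(1)[of n] dist_triangle[of bp "u n" "v n"]
    by (simp add: infdist_notempty cInf_eq_Min dist_commute)
  have "filterlim (\<lambda>n. dist bp (u n) - \<bar>D\<bar>) at_top sequentially"
    using filterlim_tendsto_add_at_top[OF tendsto_const[of "- \<bar>D\<bar>"] assms(2)] by simp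
  then show ?thesis
    unfolding escaping_def by (rule filterlim_at_top_mono) (intro always_eventually allI le)
qed

lemma asymptotic_close:
  fixes u v :: "nat \<Rightarrow> 'a::metric_space"
  assumes geod: "geodesic_space TYPE('a)" and B: "convergence_cond_B bp emb R" and R: "equiv X R"
    and "\<And>n. dist (u n) (v n) \<le> D" and "filterlim (\<lambda>n. dist bp (u n)) at_top sequentially"
  shows "asymptotic emb R u v"
  by (rule asymptotic_cones[OF B R, where S="\<lambda>n. {u n, v n}" and C=D and L="max 1 D" and p=bp])
    (use assms in \<open>auto intro!: contracting_doubleton quasi_geodesic_doubleton escaping_doubleton mem_cone_through\<close>)

text \<open>Closed balls are compact by properness, so their images are closed and miss the
  boundary; a sequence converging to the boundary leaves each of them.\<close>

lemma filterlim_dist_at_boundary: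
  fixes emb :: "'a::heine_borel \<Rightarrow> 'b::metric_space"
  assumes emb: "metrizable_compactification emb" and lim: "(\<lambda>n. emb (x n)) \<longlonglongrightarrow> \<zeta>" and "\<zeta> \<in> bdry emb"
  shows "filterlim (\<lambda>n. dist p (x n)) at_top sequentially"
  unfolding filterlim_at_top
proof
  fix r :: real
  have "continuous_on UNIV emb"
    using emb by (auto simp: metrizable_compactification_def homeomorphism_def)
  then have "compact (emb ` cball p r)"
    by (intro compact_continuous_image) (auto intro: continuous_on_subset)
  then have "open (- emb ` cball p r)" by (simp add: compact_imp_closed open_closed)
  moreover have "\<zeta> \<in> - emb ` cball p r" using \<open>\<zeta> \<in> bdry emb\<close> by (auto simp: bdry_def)
  ultimately have "eventually (\<lambda>n. emb (x n) \<in> - emb ` cball p r) sequentially"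
    using lim topological_tendstoD by fastforce
  then show "eventually (\<lambda>n. r \<le> dist p (x n)) sequentially"
    by eventually_elim (metis ComplD image_eqI linear mem_cball)
qed

context orbit_axis
begin

text \<open>Rounding down extends the parametrization from the integers to the line, and
  \<open>3 * L\<close> absorbs the rounding errors.\<close>

lemma quasi_geodesic_axis:
  assumes h: "h \<in> G"
  shows "quasi_geodesic (3 * L) (axis h)"
proof -
  define f where "f t = h (F \<lfloor>t\<rfloor> bp)" for t :: real
  have "qi_embedding_on (3 * L) UNIV f"
    unfolding qi_embedding_on_def
  proof (intro conjI ballI)
    show "1 \<le> 3 * L" using L by simp
    fix s t :: real
    define d e where "d = \<bar>real_of_int \<lfloor>s\<rfloor> - real_of_int \<lfloor>t\<rfloor>\<bar>" and "e = \<bar>s - t\<bar>"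
    have de: "d \<le> e + 1" "e \<le> d + 1" unfolding d_def e_def by linarith+
    have f: "dist (f s) (f t) = dist (F \<lfloor>s\<rfloor> bp) (F \<lfloor>t\<rfloor> bp)" by (simp add: f_def dist_G h)
    have "d / L - L \<le> dist (f s) (f t)" using lower by (simp add: f d_def)
    moreover have "e / (3 * L) \<le> e / L" using L by (intro divide_left_mono) (auto simp: e_def)
    moreover have "e / L \<le> (d + 1) / L" using de L by (intro divide_right_mono) auto
    moreover have "(d + 1) / L = d / L + 1 / L" by (simp add: add_divide_distrib)
    moreover have "1 / L \<le> 1" using L by simp
    ultimately show "\<bar>s - t\<bar> / (3 * L) - 3 * L \<le> dist (f s) (f t)"
      using L unfolding e_def by linarith
    have "dist (f s) (f t) \<le> L * d + L" using upper by (simp add: f d_def)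
    also have "\<dots> \<le> L * (e + 1) + L" using de L by simp
    also have "\<dots> \<le> (3 * L) * e + 3 * L" using L by (simp add: algebra_simps e_def)
    finally show "dist (f s) (f t) \<le> 3 * L * \<bar>s - t\<bar> + 3 * L" by (simp add: e_def)
  qed
  moreover have "axis h = f ` UNIV"
  proof -
    have "h (F n bp) = f (real_of_int n)" for n by (simp add: f_def)
    then have "axis h \<subseteq> range f" by (auto simp: axis_def)
    moreover have "range f \<subseteq> axis h" by (auto simp: axis_def f_def)
    ultimately show ?thesis by blast
  qed
  ultimately show ?thesis unfolding quasi_geodesic_def by blast
qed

text \<open>Some \<open>z bp\<close> projects to a point \<open>a\<close> far from the projection of
  \<open>bp\<close>, so the geodesic from \<open>bp\<close> to \<open>z bp\<close> passes at some
  \<open>w\<close> near \<open>a\<close>. Thus \<open>w\<close> links the axis to the orbit, and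
  \<open>z bp\<close> is at least as far from \<open>bp\<close> as \<open>w\<close>.\<close>

lemma orbit_along_axis:
  assumes h: "h \<in> G" and Z: "\<not> projects_boundedly (axis h) (orbit_of Z)"
  shows "\<exists>z a w. z \<in> Z \<and> a \<in> axis h \<and> dist a w \<le> 10 * C \<and> dist bp w \<le> dist bp (z bp) \<and> z bp \<in> cone_through bp {w}"
proof -
  interpret hA: contracting_subset C "axis h" by (rule contracting_axis[OF h])
  obtain q where q: "q \<in> nearest_points (axis h) bp" by (rule hA.nearest_pointE)
  have "\<not> (\<forall>y\<in>orbit_of Z. \<forall>a\<in>nearest_points (axis h) y. dist bp a \<le> dist bp q + 8 * C)"
    using Z unfolding projects_boundedly_iff[of _ _ bp] by simp
  then obtain z a where z: "z \<in> Z" and a: "a \<in> nearest_points (axis h) (z bp)" "dist bp a > dist bp q + 8 * C"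
    unfolding orbit_of_def by (auto simp: not_le)
  have qa: "dist q a > 8 * C" using a(2) dist_triangle[of bp a q] by linarith
  obtain T where T: "geodesic_segment T bp (z bp)" using geod by (auto simp: geodesic_space_def)
  obtain w where w: "w \<in> T" "dist w a \<le> 10 * C"
    by (rule hA.geodesic_near_projection[OF T q a(1) qa])
  have "dist bp w \<le> dist bp (z bp)"
  proof -
    obtain \<gamma> where \<gamma>: "\<gamma> 0 = bp" "\<gamma> (dist bp (z bp)) = z bp" "T = \<gamma> ` {0..dist bp (z bp)}"
      "\<And>s t. \<lbrakk>0 \<le> s; s \<le> dist bp (z bp); 0 \<le> t; t \<le> dist bp (z bp)\<rbrakk> \<Longrightarrow> dist (\<gamma> s) (\<gamma> t) = \<bar>s - t\<bar>"
      by (fact geodesic_segmentE[OF T])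
    obtain t where "0 \<le> t" "t \<le> dist bp (z bp)" "w = \<gamma> t" using w(1) \<gamma>(3) by auto
    then show ?thesis using \<gamma>(4)[of 0 t] \<gamma>(1) by simp
  qed
  moreover have "dist a w \<le> 10 * C" using w(2) by (simp add: dist_commute)
  moreover have "z bp \<in> cone_through bp {w}" using T w(1) by (auto simp: cone_through_def)
  ultimately show ?thesis using z hA.nearest_pointD[OF a(1)] by blast
qed

text \<open>Consecutive members of the chain \<open>g n bp\<close>, \<open>h n bp\<close>,
  \<open>a n\<close>, \<open>w n\<close>, \<open>z n bp\<close>, \<open>p (z n bp)\<close> are
  asymptotic. Along a subsequence the last two converge to \<open>\<mu>\<close> and
  \<open>act p \<mu>\<close>, which therefore both lie in the class of
  \<open>\<zeta>\<close>.\<close>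

lemma elliptic_radicalI:
  fixes emb :: "'a \<Rightarrow> 'b::metric_space"
  assumes spread: "\<And>D. \<exists>k\<in>G. infdist (k bp) (axis id) > D"
    and emb: "metrizable_compactification emb" and act: "extends_isom_action emb act"
    and R: "invariant_partition emb act R" and B: "convergence_cond_B bp emb R"
    and p: "p \<in> Isom"
    and Z: "\<And>h. h \<in> G \<Longrightarrow> \<not> projects_boundedly (axis h) (orbit_of {z \<in> G. z \<circ> p = p \<circ> z})"
  shows "p \<in> elliptic_radical bp emb act R G"
proof -
  have eq: "equiv (bdry emb) R" and inv: "\<And>\<xi>. \<xi> \<in> bdry emb \<Longrightarrow> act p ` (R `` {\<xi>}) = R `` {act p \<xi>}"
    using R p by (auto simp: invariant_partition_def)
  have comp: "compact (UNIV :: 'b set)" using emb by (simp add: metrizable_compactification_def)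
  have tr: "trans R" using eq by (rule equivE)
  obtain k where k: "k \<in> G" "\<And>R. \<exists>T. \<forall>g\<in>G. infdist bp (axis g) \<le> R \<and> infdist bp (axis (g \<circ> k)) \<le> R \<longrightarrow>
    dist bp (g bp) \<le> T"
    by (fact independent_axes_diverge[OF spread])
  have "act p ` (R `` {\<xi>}) = R `` {\<xi>}"
    if \<xi>: "\<xi> \<in> bdry emb" "R `` {\<xi>} \<subseteq> R `` orbit_limit_set bp emb G" for \<xi>
  proof -
    have "\<xi> \<in> R `` {\<xi>}" using eq \<xi>(1) by (rule equiv_class_self)
    then obtain \<zeta> where l: "\<zeta> \<in> orbit_limit_set bp emb G" "(\<zeta>, \<xi>) \<in> R" using \<xi>(2) by blast
    then have lb: "\<zeta> \<in> bdry emb" and "\<zeta> islimpt (\<lambda>g. emb (g bp)) ` G" by (auto simp: orbit_limit_set_def)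
    then obtain x where x: "\<And>n::nat. x n \<in> (\<lambda>g. emb (g bp)) ` G" "x \<longlonglongrightarrow> \<zeta>"
      unfolding islimpt_sequential by blast
    then have "\<forall>n. \<exists>g. g \<in> G \<and> x n = emb (g bp)" by auto
    then obtain g where g: "\<And>n. g n \<in> G" "\<And>n. x n = emb (g n bp)" by metis
    have lim: "(\<lambda>n. emb (g n bp)) \<longlonglongrightarrow> \<zeta>" using x(2) unfolding g(2) .
    note g_esc = filterlim_dist_at_boundary[OF emb lim lb, of bp]
    \<comment> \<open>The farther of two axes, which escapes by
      \<open>independent_axes_diverge\<close>. Passing from \<open>g n\<close> to
      \<open>g n \<circ> k\<close> moves the orbit point only by
      \<open>dist bp (k bp)\<close>.\<close>
    define h where "h n = (if infdist bp (axis (g n)) \<ge> infdist bp (axis (g n \<circ> k)) then g n else g n \<circ> k)" for n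
    have h: "h n \<in> G" for n using g k comp_closed by (simp add: h_def)
    have h_esc: "escaping bp (\<lambda>n. axis (h n))"
      unfolding escaping_def filterlim_at_top
    proof
      fix r :: real
      obtain T where T: "\<And>g. \<lbrakk>g \<in> G; infdist bp (axis g) \<le> r; infdist bp (axis (g \<circ> k)) \<le> r\<rbrakk> \<Longrightarrow> dist bp (g bp) \<le> T"
        using k(2)[of r] by blast
      have "eventually (\<lambda>n. T + 1 \<le> dist bp (g n bp)) sequentially"
        using g_esc by (simp add: filterlim_at_top)
      then show "eventually (\<lambda>n. r \<le> infdist bp (axis (h n))) sequentially"
      proof eventually_elim
        case (elim n)
        show ?case
        proof (rule ccontr)
          assume "\<not> ?case"
          then have "infdist bp (axis (g n)) \<le> r" "infdist bp (axis (g n \<circ> k)) \<le> r"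
            by (auto simp: h_def split: if_splits)
          from T[OF g(1) this] show False using elim by simp
        qed
      qed
    qed
    have "\<forall>n. \<exists>z a w. z \<in> {z \<in> G. z \<circ> p = p \<circ> z} \<and> a \<in> axis (h n) \<and> dist a w \<le> 10 * C \<and>
        dist bp w \<le> dist bp (z bp) \<and> z bp \<in> cone_through bp {w}"
      using orbit_along_axis[OF h Z[OF h]] by blast
    from choice[OF this] obtain z where "\<forall>n. \<exists>a w. z n \<in> {z \<in> G. z \<circ> p = p \<circ> z} \<and> a \<in> axis (h n) \<and>
        dist a w \<le> 10 * C \<and> dist bp w \<le> dist bp (z n bp) \<and> z n bp \<in> cone_through bp {w}" ..
    from choice[OF this] obtain a where "\<forall>n. \<exists>w. z n \<in> {z \<in> G. z \<circ> p = p \<circ> z} \<and> a n \<in> axis (h n) \<and>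
        dist (a n) w \<le> 10 * C \<and> dist bp w \<le> dist bp (z n bp) \<and> z n bp \<in> cone_through bp {w}" ..
    from choice[OF this] obtain w where
      z: "\<And>n. z n \<in> {z \<in> G. z \<circ> p = p \<circ> z}" and a: "\<And>n. a n \<in> axis (h n)"
      and aw: "\<And>n. dist (a n) (w n) \<le> 10 * C" and wz: "\<And>n. dist bp (w n) \<le> dist bp (z n bp)"
      and zc: "\<And>n. z n bp \<in> cone_through bp {w n}" by blast
    have a_esc: "filterlim (\<lambda>n. dist bp (a n)) at_top sequentially"
      by (rule filterlim_at_top_mono[OF h_esc[unfolded escaping_def]]) (simp add: a infdist_le)
    have "escaping bp (\<lambda>n. {a n, w n})" by (rule escaping_doubleton[OF aw a_esc])
    then have w_esc: "filterlim (\<lambda>n. dist bp (w n)) at_top sequentially"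
      unfolding escaping_def by (rule filterlim_at_top_mono) (simp add: infdist_le)
    have z_esc: "filterlim (\<lambda>n. dist bp (z n bp)) at_top sequentially"
      by (rule filterlim_at_top_mono[OF w_esc]) (simp add: wz)
    have 1: "asymptotic emb R (\<lambda>n. g n bp) (\<lambda>n. h n bp)"
    proof (rule asymptotic_close[OF geod B eq _ g_esc])
      show "dist (g n bp) (h n bp) \<le> dist bp (k bp)" for n by (simp add: h_def dist_G g)
    qed
    have 2: "asymptotic emb R (\<lambda>n. h n bp) a"
      using contracting_axis[OF h] quasi_geodesic_axis[OF h] a mem_axis
      by (intro asymptotic_cones[OF B eq _ _ h_esc, where C=C and L="3 * L" and p=bp])
        (auto simp: contracting_subset_def intro: mem_cone_through[OF geod])
    have 3: "asymptotic emb R a w" by (rule asymptotic_close[OF geod B eq aw a_esc])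
    \<comment> \<open>A singleton is a degenerate pair, so condition B also applies to the cones
      through \<open>w n\<close>, which contain \<open>z n bp\<close>.\<close>
    have "escaping bp (\<lambda>n. {w n, w n})" by (rule escaping_doubleton[OF _ w_esc, of _ 0]) simp
    then have 4: "asymptotic emb R w (\<lambda>n. z n bp)"
      using contracting_doubleton[of "w n" "w n" 0 for n] quasi_geodesic_doubleton[of "w n" "w n" 0 for n] zc
      by (intro asymptotic_cones[OF B eq, where S="\<lambda>n. {w n}" and C=0 and L="max 1 0" and p=bp])
        (auto intro: mem_cone_through[OF geod])
    \<comment> \<open>Since \<open>z n\<close> commutes with \<open>p\<close>, the displacement of
      \<open>z n bp\<close> under \<open>p\<close> equals that of \<open>bp\<close>.\<close>
    have 5: "asymptotic emb R (\<lambda>n. z n bp) (\<lambda>n. p (z n bp))"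
    proof (rule asymptotic_close[OF geod B eq _ z_esc])
      show "dist (z n bp) (p (z n bp)) \<le> dist bp (p bp)" for n
      proof -
        have "z n \<circ> p = p \<circ> z n" using z[of n] by blast
        from fun_cong[OF this, of bp] have "p (z n bp) = z n (p bp)" by simp
        then show ?thesis using z[of n] by (simp add: dist_G)
      qed
    qed
    note as = asymptotic_trans[OF comp tr asymptotic_trans[OF comp tr asymptotic_trans[OF comp tr 1 2] 3] 4]
    obtain \<mu> r where r: "strict_mono (r::nat \<Rightarrow> nat)" "((\<lambda>n. emb (z n bp)) \<circ> r) \<longlonglongrightarrow> \<mu>"
      using comp unfolding compact_def by (metis UNIV_I)
    then have zlim: "(\<lambda>n. emb (z (r n) bp)) \<longlonglongrightarrow> \<mu>" by (simp add: o_def)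
    have glim: "(\<lambda>n. emb (g (r n) bp)) \<longlonglongrightarrow> \<zeta>"
      using LIMSEQ_subseq_LIMSEQ[OF lim r(1)] by (simp add: o_def)
    have "continuous_on UNIV (act p)"
      using act p by (auto simp: extends_isom_action_def homeomorphism_def)
    then have "(\<lambda>n. act p (emb (z (r n) bp))) \<longlonglongrightarrow> act p \<mu>"
      by (intro continuous_on_tendsto_compose[OF _ zlim]) auto
    moreover have "act p (emb y) = emb (p y)" for y using act p by (simp add: extends_isom_action_def)
    ultimately have pzlim: "(\<lambda>n. emb (p (z (r n) bp))) \<longlonglongrightarrow> act p \<mu>" by simp
    have lm: "(\<zeta>, \<mu>) \<in> R" using as r(1) glim zlim unfolding asymptotic_def by blast
    have lpm: "(\<zeta>, act p \<mu>) \<in> R"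
      using asymptotic_trans[OF comp tr as 5] r(1) glim pzlim unfolding asymptotic_def by blast
    have "\<mu> \<in> bdry emb" using lm eq by (auto simp: equiv_def refl_on_def)
    have "R `` {\<xi>} = R `` {\<mu>}" using equiv_class_eq[OF eq l(2)] equiv_class_eq[OF eq lm] by simp
    then have "act p ` (R `` {\<xi>}) = R `` {act p \<mu>}" using inv[OF \<open>\<mu> \<in> bdry emb\<close>] by simp
    also have "\<dots> = R `` {\<xi>}" using equiv_class_eq[OF eq lpm] equiv_class_eq[OF eq l(2)] by simp
    finally show ?thesis .
  qed
  then show ?thesis using p by (auto simp: elliptic_radical_def)
qed

end

section \<open>Counting orbit points\<close>

lemma m_inv_isom_group:
  assumes "g \<in> Isom"
  shows "inv\<^bsub>isom_group\<^esub> g = inv_into UNIV g"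
proof -
  have b: "bij g" using assms by (simp add: Isom_def)
  have "dist (inv_into UNIV g x) (inv_into UNIV g y) = dist x y" for x y
    using assms b surj_f_inv_f[OF bij_is_surj[OF b]] unfolding Isom_def by (metis (mono_tags, lifting) mem_Collect_eq)
  then have "inv_into UNIV g \<in> Isom" using b by (simp add: Isom_def bij_imp_bij_inv)
  then show ?thesis
    using assms b by (intro group.inv_equality[OF group_isom_group]) (auto simp: isom_group_def bij_is_inj)
qed

lemma isom_subgroupD:
  assumes "subgroup G isom_group"
  shows "G \<subseteq> Isom" "\<And>g h. g \<in> G \<Longrightarrow> h \<in> G \<Longrightarrow> g \<circ> h \<in> G" "\<And>g. g \<in> G \<Longrightarrow> inv_into UNIV g \<in> G" "id \<in> G"
proof -
  show G: "G \<subseteq> Isom" using subgroup.subset[OF assms] by (simp add: isom_group_def)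
  show "g \<circ> h \<in> G" if "g \<in> G" "h \<in> G" for g h
    using subgroup.m_closed[OF assms that] by (simp add: isom_group_def)
  show "inv_into UNIV g \<in> G" if "g \<in> G" for g
    using subgroup.m_inv_closed[OF assms that] that G by (auto simp: m_inv_isom_group)
  show "id \<in> G" using subgroup.one_closed[OF assms] by (simp add: isom_group_def)
qed

lemma compact_pointwise:
  fixes K :: "'i \<Rightarrow> 'b::topological_space set"
  assumes "\<And>i. compact (K i)"
  shows "compact {f. \<forall>i. f i \<in> K i}"
proof -
  have "compactin (product_topology (\<lambda>i. euclidean) UNIV) (PiE UNIV K)"
    unfolding compactin_PiE using assms by simp
  moreover have "PiE UNIV K = {f. \<forall>i. f i \<in> K i}" by (auto simp: PiE_def)
  ultimately show ?thesis by (simp add: euclidean_product_topology)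
qed

text \<open>Infinitely many elements of bounded displacement accumulate pointwise at some map
  \<open>\<phi>\<close> by Tychonoff's theorem. Two distinct ones close to \<open>\<phi>\<close> on
  a finite set have a quotient in a neighbourhood of \<open>id\<close> that contains no other
  element of \<open>G\<close>.\<close>

lemma discrete_isom_finite_ball:
  fixes p :: "'a::heine_borel"
  assumes "discrete_isom_subgroup G"
  shows "finite {g \<in> G. dist p (g p) \<le> r}"
proof (rule ccontr)
  define T where "T = {g \<in> G. dist p (g p) \<le> r}"
  assume "infinite {g \<in> G. dist p (g p) \<le> r}"
  then have inf: "infinite T" by (simp add: T_def)
  have sub: "subgroup G isom_group" and disc: "discrete G"
    using assms by (auto simp: discrete_isom_subgroup_def)
  note G = isom_subgroupD[OF sub]
  have iso: "dist (g x) (g y) = dist x y" if "g \<in> G" for g x y using that G(1) by (auto simp: Isom_def)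
  have bij: "bij g" if "g \<in> G" for g using that G(1) by (auto simp: Isom_def)
  have "compact {f :: 'a \<Rightarrow> 'a. \<forall>x. f x \<in> cball p (r + dist p x)}" by (rule compact_pointwise) simp
  moreover have "T \<subseteq> {f. \<forall>x. f x \<in> cball p (r + dist p x)}"
  proof safe
    fix g x assume "g \<in> T"
    then show "g x \<in> cball p (r + dist p x)"
      using dist_triangle[of p "g x" "g p"] iso[of g p x] by (auto simp: T_def)
  qed
  ultimately obtain \<phi> where \<phi>: "\<phi> islimpt T" using Heine_Borel_imp_Bolzano_Weierstrass inf by blast
  obtain U where U: "open U" "U \<inter> G = {id}"
    using discreteD[OF disc G(4)] by (auto simp: isolated_in_def)
  then have "openin (product_topology (\<lambda>i. euclidean) UNIV) U" "id \<in> U"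
    by (auto simp: euclidean_product_topology)
  from product_topology_open_contains_basis[OF this] obtain X where
    X: "id \<in> PiE UNIV X" "\<forall>i. openin euclidean (X i)" "finite {i. X i \<noteq> topspace euclidean}" "PiE UNIV X \<subseteq> U" by blast
  define D where "D = {i. X i \<noteq> UNIV}"
  have D: "finite D" using X(3) by (simp add: D_def)
  have "\<forall>i. \<exists>e>0. ball i e \<subseteq> X i"
  proof
    fix i
    have "open (X i)" "i \<in> X i" using X(1,2) by (auto simp: PiE_def Pi_def)
    then show "\<exists>e>0. ball i e \<subseteq> X i" by (meson open_contains_ball)
  qed
  then obtain e where e: "\<And>i. e i > 0" "\<And>i. ball i (e i) \<subseteq> X i" by metis
  \<comment> \<open>Half radii ensure that two maps in \<open>V\<close> differ by less than
    \<open>e i\<close> at each \<open>i\<close> in \<open>D\<close>.\<close>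
  define V where "V = {\<psi>. \<forall>i\<in>D. \<psi> i \<in> ball (\<phi> i) (e i / 2)}"
  have V: "open V"
    unfolding V_def by (rule product_topology_basis'[OF D, where x="\<lambda>i. i"]) auto
  have \<phi>V: "\<phi> \<in> V" using e by (auto simp: V_def)
  obtain g where g: "g \<in> T" "g \<in> V" "g \<noteq> \<phi>" by (rule islimptE[OF \<phi> \<phi>V V])
  then obtain x where x: "g x \<noteq> \<phi> x" by auto
  have "open {\<psi> :: 'a \<Rightarrow> 'a. \<forall>i\<in>{x}. \<psi> i \<in> - {g x}}"
    by (rule product_topology_basis'[where x="\<lambda>i. i" and U="\<lambda>_. - {g x}"]) auto
  \<comment> \<open>Excluding the value \<open>g x\<close> at \<open>x\<close> keeps
    \<open>\<phi>\<close> in the open set and forces the next element to differ from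
    \<open>g\<close>.\<close>
  then have W: "open (V \<inter> {\<psi>. \<psi> x \<noteq> g x})" using V by (intro open_Int) simp_all
  have \<phi>W: "\<phi> \<in> V \<inter> {\<psi>. \<psi> x \<noteq> g x}" using \<phi>V x by simp
  obtain g' where g': "g' \<in> T" "g' \<in> V \<inter> {\<psi>. \<psi> x \<noteq> g x}" by (rule islimptE[OF \<phi> \<phi>W W])
  then have g'V: "g' \<in> V" and g'x: "g' x \<noteq> g x" by simp_all
  define h where "h = inv_into UNIV g \<circ> g'"
  have gG: "g \<in> G" "g' \<in> G" using g g' by (auto simp: T_def)
  have gh: "g (h i) = g' i" for i
    using bij_is_surj[OF bij[OF gG(1)]] by (simp add: h_def surj_f_inv_f)
  have "h i \<in> X i" for i
  proof (cases "i \<in> D")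
    case True
    have "dist i (h i) = dist (g i) (g' i)" using iso[OF gG(1), of i "h i"] by (simp add: gh)
    also have "\<dots> < e i"
      using g(2) g'V True dist_triangle2[of "g i" "g' i" "\<phi> i"] by (fastforce simp: V_def dist_commute)
    finally show ?thesis using e(2)[of i] by auto
  next
    case False
    then show ?thesis by (simp add: D_def)
  qed
  then have "h \<in> U" using X(4) by (auto simp: PiE_def)
  moreover have "h \<in> G" using gG G(2,3) by (simp add: h_def)
  ultimately have "h = id" using U(2) by blast
  then show False using gh[of x] g'x by simp
qed

lemma card_le_fibres:
  assumes "finite S" and "\<And>x. x \<in> S \<Longrightarrow> card {y \<in> S. f y = f x} \<le> N"
  shows "card S \<le> N * card (f ` S)"
proof -
  have "card S = card (\<Union>t\<in>f ` S. {y \<in> S. f y = t})" by (rule arg_cong[of _ _ card]) auto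
  also have "\<dots> \<le> (\<Sum>t\<in>f ` S. card {y \<in> S. f y = t})" by (rule card_UN_le) (simp add: assms)
  also have "\<dots> \<le> (\<Sum>t\<in>f ` S. N)" by (rule sum_mono) (use assms(2) in auto)
  finally show ?thesis by (simp add: mult.commute)
qed

lemma orbit_ball_image: "{h p |h. h \<in> G \<and> dist p (h p) \<le> r} = (\<lambda>h. h p) ` {h \<in> G. dist p (h p) \<le> r}"
  by blast

text \<open>If the claim failed, \<open>b m\<close> would eventually be at most
  \<open>exp (y * m)\<close> for some \<open>y\<close> below half the exponent of \<open>a\<close>.
  With \<open>m = 2 * n + M\<close> the exponent of \<open>a\<close> is at most
  \<open>2 * y\<close>, as \<open>K\<close> and \<open>M\<close> contribute only
  \<open>c / real n\<close>.\<close>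

lemma limsup_ln_comparison:
  fixes a b :: "nat \<Rightarrow> nat"
  assumes le: "\<And>n. a n \<le> K * b (2 * n + M)" and pos: "\<And>n. 0 < a n"
    and fin: "limsup (\<lambda>n. ereal (ln (real (a n)) / real n)) \<noteq> \<infinity>"
  shows "limsup (\<lambda>n. ereal (ln (real (a n)) / real n)) / 2 \<le> limsup (\<lambda>n. ereal (ln (real (b n)) / real n))"
    (is "?A / 2 \<le> ?B")
proof (rule ccontr)
  have "?A \<ge> 0"
    using Limsup_mono[of "\<lambda>_. 0" "\<lambda>n. ereal (ln (real (a n)) / real n)" sequentially] pos
    by (simp add: Suc_leI Limsup_const)
  then obtain A where A: "?A = ereal A" using fin by (cases ?A) auto
  assume "\<not> ?A / 2 \<le> ?B"
  then have "?B < ereal (A / 2)" by (simp add: A not_le)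
  then obtain y where y: "?B < ereal y" "y < A / 2" using ereal_dense2 by fastforce
  have K: "K > 0" using le[of 0] pos[of 0] by (intro gr0I) auto
  define c where "c = ln (real K) + y * real M"
  from Limsup_lessD[OF y(1)] obtain N where N: "\<And>m. m \<ge> N \<Longrightarrow> ln (real (b m)) / real m < y"
    by (auto simp: eventually_sequentially)
  have "eventually (\<lambda>n. ereal (ln (real (a n)) / real n) \<le> ereal (2 * y + c / real n)) sequentially"
    unfolding eventually_sequentially
  proof (intro exI[of _ "max N 1"] allI impI)
    fix n assume n: "max N 1 \<le> n"
    define m where "m = 2 * n + M"
    have m: "N \<le> m" "real m > 0" using n by (auto simp: m_def)
    have b: "b m > 0" using le[of n] pos[of n] by (intro gr0I) (auto simp: m_def)
    have "real (a n) \<le> real (K * b m)" using le[of n] unfolding m_def by (rule of_nat_mono)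
    then have "ln (real (a n)) \<le> ln (real K * real (b m))" using pos[of n] by simp
    also have "\<dots> = ln (real K) + ln (real (b m))" using K b by (simp add: ln_mult)
    also have "ln (real (b m)) \<le> y * real m" using N[OF m(1)] m(2) by (simp add: divide_less_eq)
    finally have "ln (real (a n)) \<le> 2 * y * real n + c"
      by (simp add: c_def m_def algebra_simps)
    then show "ereal (ln (real (a n)) / real n) \<le> ereal (2 * y + c / real n)"
      using n by (simp add: field_simps)
  qed
  then have "?A \<le> limsup (\<lambda>n. ereal (2 * y + c / real n))" by (rule Limsup_mono)
  also have "\<dots> = ereal (2 * y)"
  proof (rule lim_imp_Limsup)
    have "(\<lambda>n. 2 * y + c / real n) \<longlonglongrightarrow> 2 * y + 0"
      by (intro tendsto_add tendsto_const tendsto_divide_0[OF tendsto_const] filterlim_at_top_imp_at_infinity filterlim_real_sequentially)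
    then show "(\<lambda>n. ereal (2 * y + c / real n)) \<longlonglongrightarrow> ereal (2 * y)" by simp
  qed simp
  finally show False using y(2) by (simp add: A)
qed

context orbit_axis
begin

text \<open>Otherwise \<open>F (i * int m) = id\<close> for all \<open>m\<close>, against the lower
  quasi-isometry bound.\<close>

lemma F_eq_id: "F i = id \<Longrightarrow> i = 0"
proof (rule ccontr)
  assume i: "F i = id" "i \<noteq> 0"
  obtain m :: nat where m: "real m > L * L" using reals_Archimedean2 by blast
  have "F (i * int m) = F 0"
    using commute_powers[of id i 0 m] i by (simp add: F_0)
  then have "\<bar>real_of_int (i * int m) - real_of_int 0\<bar> \<le> L * L"
    using dist_axis_lower[of "i * int m" 0] by simp
  moreover have "real m \<le> \<bar>real_of_int (i * int m) - real_of_int 0\<bar>"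
  proof -
    have "1 \<le> \<bar>real_of_int i\<bar>" using i by linarith
    then show ?thesis by (simp add: abs_mult mult_le_cancel_right1)
  qed
  ultimately show False using m by simp
qed

lemma inj_F: "inj F"
proof (rule injI)
  fix m n assume "F m = F n"
  then have "F (m - n) = F n \<circ> F (- n)" using F_add[of m "- n"] by simp
  also have "\<dots> = id" using F_add[of n "- n"] by (simp add: F_0)
  finally show "m = n" using F_eq_id[of "m - n"] by simp
qed

text \<open>A power of the contracting element brings the projection of \<open>g bp\<close> back to
  \<open>bp\<close>, so every coset of the infinite cyclic group \<open>range F\<close> has a
  representative moving \<open>bp\<close> by at most \<open>D\<close>; there are finitely many of
  these.\<close>

lemma virtually_Z_if_near_axis:
  assumes sub: "subgroup G isom_group" and near: "\<And>k. k \<in> G \<Longrightarrow> infdist (k bp) (axis id) \<le> D"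
  shows "virtually_Z (isom_group\<lparr>carrier := G\<rparr>)"
proof -
  let ?G = "isom_group\<lparr>carrier := G\<rparr>"
  have grp: "group ?G" by (rule subgroup.subgroup_is_group[OF sub group_isom_group])
  define K where "K = range F"
  have KG: "K \<subseteq> G" using F_mem by (auto simp: K_def)
  have inv: "inv\<^bsub>?G\<^esub> F n = F (- n)" for n
    using F_mem F_add[of "- n" n] by (intro group.inv_equality[OF grp]) (auto simp: isom_group_def F_0)
  have subK: "subgroup K ?G"
  proof (rule group.subgroupI[OF grp])
    show "inv\<^bsub>?G\<^esub> a \<in> K" if "a \<in> K" for a using that inv by (auto simp: K_def)
    show "a \<otimes>\<^bsub>?G\<^esub> b \<in> K" if ab: "a \<in> K" "b \<in> K" for a b
    proof -
      obtain m n where "a = F m" "b = F n" using ab by (auto simp: K_def)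
      then have "a \<otimes>\<^bsub>?G\<^esub> b = F (m + n)" by (simp add: isom_group_def F_add)
      then show ?thesis by (simp add: K_def)
    qed
  qed (use KG in \<open>auto simp: K_def\<close>)
  have "rcosets\<^bsub>?G\<^esub> K \<subseteq> (\<lambda>u. K #>\<^bsub>?G\<^esub> u) ` {u \<in> G. dist bp (u bp) \<le> D}"
  proof
    fix S assume "S \<in> rcosets\<^bsub>?G\<^esub> K"
    then obtain g where g: "g \<in> G" "S = K #>\<^bsub>?G\<^esub> g" by (auto simp: RCOSETS_def)
    obtain a where a: "a \<in> nearest_points (axis id) (g bp)" by (rule A.nearest_pointE)
    then obtain n where n: "a = F n bp" using A.nearest_pointD by (fastforce simp: axis_def)
    define u where "u = F (- n) \<circ> g"
    have u: "u \<in> G" using g F_mem comp_closed by (simp add: u_def)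
    have "dist bp (u bp) = dist (F n bp) (g bp)"
      using dist_G[OF F_mem[of n], of bp "u bp"] by (simp add: u_def)
    also have "\<dots> \<le> D" using A.nearest_pointD[OF a] near[OF g(1)] by (simp add: n dist_commute)
    finally have uD: "dist bp (u bp) \<le> D" .
    have "u \<in> K #>\<^bsub>?G\<^esub> g" by (auto simp: u_def r_coset_def K_def isom_group_def)
    then have "S = K #>\<^bsub>?G\<^esub> u" using group.repr_independence[OF grp _ _ subK, of u g] g by simp
    then show "S \<in> (\<lambda>u. K #>\<^bsub>?G\<^esub> u) ` {u \<in> G. dist bp (u bp) \<le> D}" using u uD by blast
  qed
  then have fin: "finite (rcosets\<^bsub>?G\<^esub> K)" by (rule finite_subset) (simp add: finite_ball)
  have "F \<in> iso integer_group (?G\<lparr>carrier := K\<rparr>)"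
    by (auto simp: iso_def hom_def bij_betw_def inj_F K_def F_add isom_group_def)
  then have "integer_group \<cong> ?G\<lparr>carrier := K\<rparr>" by (rule is_isoI)
  then have "?G\<lparr>carrier := K\<rparr> \<cong> integer_group" by (rule group.iso_sym[OF group_integer_group])
  then show ?thesis unfolding virtually_Z_def using subK fin by blast
qed

section \<open>Counting through conjugates of confining elements\<close>

lemma orbit_count:
  assumes H: "discrete_isom_subgroup H" and P: "finite P" "P \<subseteq> Isom"
    and conf: "\<And>g. g \<in> G \<Longrightarrow> \<exists>p\<in>P. \<exists>h\<in>H. h \<circ> g = g \<circ> p"
    and axis: "\<And>p. p \<in> P \<Longrightarrow> \<exists>h\<in>G. projects_boundedly (axis h) (orbit_of {z \<in> G. z \<circ> p = p \<circ> z})"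
  shows "\<exists>K M. \<forall>n. card {h bp |h. h \<in> G \<and> dist bp (h bp) \<le> real n}
    \<le> K * card {h bp |h. h \<in> H \<and> dist bp (h bp) \<le> real (2 * n + M)}"
proof -
  define Y where "Y = (\<Union>p\<in>P. orbit_of {z \<in> G. z \<circ> p = p \<circ> z})"
  have "\<exists>h\<in>G. projects_boundedly (axis h) (\<Union>Z\<in>(\<lambda>p. {z \<in> G. z \<circ> p = p \<circ> z}) ` P. orbit_of Z)"
  proof (rule common_axis)
    show "inv_into UNIV z \<circ> w \<in> Z"
      if Z: "Z \<in> (\<lambda>p. {z \<in> G. z \<circ> p = p \<circ> z}) ` P" and zZ: "z \<in> Z" "w \<in> Z" for Z z w
    proof -
      obtain p where p: "Z = {z \<in> G. z \<circ> p = p \<circ> z}" using Z by blast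
      have zw: "z \<in> G" "w \<in> G" "\<And>x. z (p x) = p (z x)" "\<And>x. w (p x) = p (w x)"
        using zZ unfolding p by (auto simp: fun_eq_iff)
      have "inv_into UNIV z (p x) = p (inv_into UNIV z x)" for x
        using zw(3)[of "inv_into UNIV z x"] zw(1) by (metis inv_G)
      then show ?thesis using zw by (auto simp: p comp_closed inv_closed fun_eq_iff)
    qed
  qed (use P axis in auto)
  then obtain h where h: "h \<in> G" "projects_boundedly (axis h) Y" by (auto simp: Y_def)
  obtain J c where J: "J \<in> G" and key: "\<And>x. \<exists>E\<in>{id, J}. \<forall>y\<in>Y.
    dist (inv_into UNIV E x) bp + dist bp y \<le> dist (inv_into UNIV E x) y + c"
    by (fact push_away[OF h])
  \<comment> \<open>\<open>key\<close> is used at the preimage of \<open>bp\<close> under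
    \<open>g\<close>; the inverses then move to the other side as isometries.\<close>
  have "\<forall>g\<in>G. \<exists>E\<in>{id, J}. \<forall>y\<in>Y. dist bp (g (E bp)) + dist bp y \<le> dist bp (g (E y)) + c"
  proof
    fix g assume g: "g \<in> G"
    obtain E where E: "E \<in> {id, J}" "\<And>y. y \<in> Y \<Longrightarrow>
      dist (inv_into UNIV E (inv_into UNIV g bp)) bp + dist bp y \<le> dist (inv_into UNIV E (inv_into UNIV g bp)) y + c"
      using key[of "inv_into UNIV g bp"] by blast
    have "E \<in> G" using E(1) J id_mem by blast
    then show "\<exists>E\<in>{id, J}. \<forall>y\<in>Y. dist bp (g (E bp)) + dist bp y \<le> dist bp (g (E y)) + c"
      using E g by (auto simp only: dist_inv_G)
  qed
  then obtain E where E: "\<And>g. g \<in> G \<Longrightarrow> E g \<in> {id, J}"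
    "\<And>g y. \<lbrakk>g \<in> G; y \<in> Y\<rbrakk> \<Longrightarrow> dist bp (g (E g bp)) + dist bp y \<le> dist bp (g (E g y)) + c"
    by (metis (no_types, lifting))
  define e where "e g = g \<circ> E g" for g
  have eG: "e g \<in> G" if "g \<in> G" for g using E(1)[OF that] that J by (auto simp: e_def comp_closed)
  have "\<forall>g\<in>G. \<exists>q. fst q \<in> P \<and> snd q \<in> H \<and> snd q \<circ> e g = e g \<circ> fst q"
    using conf eG by fastforce
  then obtain q where q: "\<And>g. g \<in> G \<Longrightarrow> fst (q g) \<in> P" "\<And>g. g \<in> G \<Longrightarrow> snd (q g) \<in> H"
    "\<And>g. g \<in> G \<Longrightarrow> snd (q g) \<circ> e g = e g \<circ> fst (q g)" by metis
  define \<Phi> where "\<Phi> g = (E g, fst (q g), snd (q g))" for g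
  define B where "B = {z \<in> G. dist bp (z bp) \<le> c}"
  have fibre: "card {g' \<in> S. \<Phi> g' = \<Phi> g} \<le> card B" if S: "S \<subseteq> G" and g: "g \<in> S" for S g
  proof -
    have gG: "g \<in> G" using S g by blast
    define p where "p = fst (q g)"
    have "{g' \<in> S. \<Phi> g' = \<Phi> g} \<subseteq> (\<lambda>z. e g \<circ> z \<circ> inv_into UNIV (E g)) ` B"
    proof
      fix g' assume "g' \<in> {g' \<in> S. \<Phi> g' = \<Phi> g}"
      then have g': "g' \<in> G" "E g' = E g" "fst (q g') = p" "snd (q g') = snd (q g)"
        using S by (auto simp: \<Phi>_def p_def)
      have EG: "E g \<in> G" using E(1)[OF gG] J id_mem by auto
      \<comment> \<open>Both \<open>e g\<close> and \<open>e g'\<close> conjugate \<open>p\<close>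
        to the same element of \<open>H\<close>, so \<open>z\<close> and its inverse
        \<open>z'\<close> centralize \<open>p\<close>.\<close>
      define z where "z = inv_into UNIV (e g) \<circ> e g'"
      define z' where "z' = inv_into UNIV (e g') \<circ> e g"
      have zG: "z \<in> G" "z' \<in> G" using eG[OF gG] eG[OF g'(1)] by (auto simp: z_def z'_def comp_closed inv_closed)
      have ez: "e g (z x) = e g' x" "e g' (z' x) = e g x" for x
        using eG[OF gG] eG[OF g'(1)] by (auto simp: z_def z'_def)
      have hp: "snd (q g) (e g x) = e g (p x)" "snd (q g) (e g' x) = e g' (p x)" for x
        using fun_cong[OF q(3)[OF gG], of x] fun_cong[OF q(3)[OF g'(1)], of x] g' by (auto simp: p_def)
      have "e g (z (p x)) = e g (p (z x))" for x using hp(1)[of "z x"] hp(2)[of x] by (simp add: ez)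
      then have "z (p x) = p (z x)" for x using inv_G(1)[OF eG[OF gG]] by metis
      then have zY: "z bp \<in> Y"
        unfolding Y_def orbit_of_def using q(1)[OF gG] zG by (auto simp: p_def fun_eq_iff intro!: bexI[of _ p])
      have "e g' (z' (p x)) = e g' (p (z' x))" for x using hp(2)[of "z' x"] hp(1)[of x] by (simp add: ez)
      then have "z' (p x) = p (z' x)" for x using inv_G(1)[OF eG[OF g'(1)]] by metis
      then have z'Y: "z' bp \<in> Y"
        unfolding Y_def orbit_of_def using q(1)[OF gG] zG by (auto simp: p_def fun_eq_iff intro!: bexI[of _ p])
      have "dist bp (z' bp) = dist (e g' bp) (e g' (z' bp))" by (simp add: dist_G eG g'(1))
      also have "\<dots> = dist (e g (z bp)) (e g bp)" by (simp add: ez)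
      also have "\<dots> = dist bp (z bp)" by (simp add: dist_G eG gG dist_commute)
      finally have zz: "dist bp (z' bp) = dist bp (z bp)" .
      have "dist bp (e g bp) + dist bp (z bp) \<le> dist bp (e g' bp) + c"
        using E(2)[OF gG zY] ez(1)[of bp] by (simp add: e_def)
      moreover have "dist bp (e g' bp) + dist bp (z' bp) \<le> dist bp (e g bp) + c"
        using E(2)[OF g'(1) z'Y] ez(2)[of bp] by (simp add: e_def)
      \<comment> \<open>Adding the two inequalities cancels the displacements of \<open>e g\<close>
        and \<open>e g'\<close> and leaves \<open>2 * dist bp (z bp) \<le> 2 * c\<close>.\<close>
      ultimately have "z \<in> B" using zz zG by (simp add: B_def)
      moreover have "g' = e g \<circ> z \<circ> inv_into UNIV (E g)"
      proof
        fix x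
        show "g' x = (e g \<circ> z \<circ> inv_into UNIV (E g)) x"
          using ez(1)[of "inv_into UNIV (E g) x"] EG by (simp add: e_def g'(2))
      qed
      ultimately show "g' \<in> (\<lambda>z. e g \<circ> z \<circ> inv_into UNIV (E g)) ` B" by blast
    qed
    then show ?thesis
      using surj_card_le[of B] finite_ball[of c] unfolding B_def by blast
  qed
  have subH: "subgroup H isom_group" using H by (simp add: discrete_isom_subgroup_def)
  note Hs = isom_subgroupD[OF subH]
  have finH: "finite {h \<in> H. dist bp (h bp) \<le> r}" for r by (rule discrete_isom_finite_ball[OF H])
  \<comment> \<open>The order of the stabilizer of \<open>bp\<close> in \<open>H\<close>: the growth
    exponent counts orbit points, whereas \<open>\<Phi>\<close> produces group elements.\<close>
  define s where "s = card {h \<in> H. dist bp (h bp) \<le> 0}"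
  have Hcard: "card {h \<in> H. dist bp (h bp) \<le> r} \<le> s * card {h bp |h. h \<in> H \<and> dist bp (h bp) \<le> r}" for r
    unfolding orbit_ball_image
  proof (rule card_le_fibres[OF finH])
    fix h assume h: "h \<in> {h \<in> H. dist bp (h bp) \<le> r}"
    then have hb: "bij h" using Hs(1) by (auto simp: Isom_def)
    have hinv: "inv_into UNIV h (h x) = x" "h (inv_into UNIV h x) = x" for x
      using hb by (simp_all add: bij_is_inj bij_is_surj surj_f_inv_f)
    have "{k \<in> {h \<in> H. dist bp (h bp) \<le> r}. k bp = h bp} \<subseteq> (\<lambda>z. h \<circ> z) ` {h \<in> H. dist bp (h bp) \<le> 0}"
    proof
      fix k assume k: "k \<in> {k \<in> {h \<in> H. dist bp (h bp) \<le> r}. k bp = h bp}"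
      have "inv_into UNIV h \<circ> k \<in> {h \<in> H. dist bp (h bp) \<le> 0}"
        using h k Hs by (auto simp: hinv)
      moreover have "k = h \<circ> (inv_into UNIV h \<circ> k)" by (auto simp: hinv)
      ultimately show "k \<in> (\<lambda>z. h \<circ> z) ` {h \<in> H. dist bp (h bp) \<le> 0}" by blast
    qed
    then show "card {k \<in> {h \<in> H. dist bp (h bp) \<le> r}. k bp = h bp} \<le> s"
      unfolding s_def by (rule surj_card_le[OF finH])
  qed
  \<comment> \<open>The element of \<open>H\<close> is a conjugate by \<open>e g\<close>, so
    \<open>J\<close> enters twice; the sum over \<open>P\<close> bounds each single
    displacement.\<close>
  obtain M :: nat where M: "real M \<ge> 2 * dist bp (J bp) + (\<Sum>p\<in>P. dist bp (p bp))"
    using real_arch_simple by blast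
  define K where "K = card B * (card {id, J} * (card P * s))"
  have "card {h bp |h. h \<in> G \<and> dist bp (h bp) \<le> real n}
    \<le> K * card {h bp |h. h \<in> H \<and> dist bp (h bp) \<le> real (2 * n + M)}" for n
  proof -
    define S where "S = {g \<in> G. dist bp (g bp) \<le> real n}"
    define T where "T = {h \<in> H. dist bp (h bp) \<le> real (2 * n + M)}"
    have "\<Phi> ` S \<subseteq> {id, J} \<times> P \<times> T"
    proof
      fix t assume "t \<in> \<Phi> ` S"
      then obtain g where g: "g \<in> S" "t = \<Phi> g" by blast
      then have gG: "g \<in> G" and gn: "dist bp (g bp) \<le> real n" by (auto simp: S_def)
      define p h where "p = fst (q g)" and "h = snd (q g)"
      have p: "p \<in> P" and h: "h \<in> H" and hp: "h (e g bp) = e g (p bp)"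
        using q(1,2)[OF gG] fun_cong[OF q(3)[OF gG], of bp] by (simp_all add: p_def h_def)
      have hI: "dist (h x) (h y) = dist x y" for x y using h Hs(1) by (auto simp: Isom_def)
      have "dist (g bp) (e g bp) = dist bp (E g bp)" by (simp add: e_def dist_G gG)
      also have "\<dots> \<le> dist bp (J bp)" using E(1)[OF gG] by auto
      finally have eg: "dist bp (e g bp) \<le> real n + dist bp (J bp)"
        using gn dist_triangle[of bp "e g bp" "g bp"] by linarith
      have "dist bp (h bp) \<le> dist bp (e g bp) + dist (e g bp) (h (e g bp)) + dist (h (e g bp)) (h bp)"
        using dist_triangle[of bp "h bp" "e g bp"] dist_triangle[of "e g bp" "h bp" "h (e g bp)"] by linarith
      also have "\<dots> = 2 * dist bp (e g bp) + dist bp (p bp)"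
        by (simp add: hI) (simp add: hp dist_G eG gG dist_commute)
      also have "dist bp (p bp) \<le> (\<Sum>p\<in>P. dist bp (p bp))" by (rule member_le_sum[OF p _ P(1)]) simp
      finally have "dist bp (h bp) \<le> real (2 * n + M)" using eg M by simp
      then show "t \<in> {id, J} \<times> P \<times> T" using E(1)[OF gG] p h by (auto simp: g \<Phi>_def p_def h_def T_def mem_Times_iff)
    qed
    then have "card (\<Phi> ` S) \<le> card ({id, J} \<times> P \<times> T)"
      using P(1) finH by (intro card_mono finite_cartesian_product) (auto simp: T_def)
    then have 1: "card (\<Phi> ` S) \<le> card {id, J} * (card P * card T)" by (simp add: card_cartesian_product)
    have "card {h bp |h. h \<in> G \<and> dist bp (h bp) \<le> real n} \<le> card S"
      unfolding orbit_ball_image S_def by (rule card_image_le[OF finite_ball])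
    also have "\<dots> \<le> card B * card (\<Phi> ` S)"
    proof (rule card_le_fibres)
      show "finite S" unfolding S_def by (rule finite_ball)
      show "card {g' \<in> S. \<Phi> g' = \<Phi> g} \<le> card B" if "g \<in> S" for g
        by (rule fibre[OF _ that]) (simp add: S_def)
    qed
    also have "\<dots> \<le> card B * (card {id, J} * (card P * card T))" using 1 by simp
    also have "\<dots> \<le> card B * (card {id, J} * (card P * (s * card {h bp |h. h \<in> H \<and> dist bp (h bp) \<le> real (2 * n + M)})))"
      using Hcard[of "real (2 * n + M)"] unfolding T_def by (intro mult_le_mono le_refl)
    finally show ?thesis by (simp add: K_def mult.assoc)
  qed
  then show ?thesis by blast
qed

end

section \<open>The growth bound from the orbit count\<close>

theorem corollary1p16:
  fixes bp :: "'a::heine_borel"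
    and emb :: "'a \<Rightarrow> 'b::metric_space"
    and act :: "('a \<Rightarrow> 'a) \<Rightarrow> 'b \<Rightarrow> 'b"
    and R :: "('b \<times> 'b) set"
    and \<Gamma> H P :: "('a \<Rightarrow> 'a) set"
  assumes "geodesic_space TYPE('a)"
    and "discrete_isom_subgroup \<Gamma>"
    and "\<not> elementary_group (isom_group\<lparr>carrier := \<Gamma>\<rparr>)"
    and "convergence_boundary bp emb act R \<Gamma>"
    and "divergence_type bp \<Gamma>"
    and "\<exists>f\<in>\<Gamma>. contracting_isometry bp f \<and> non_pinched_isometry bp emb R f"
    and "discrete_isom_subgroup H"
    and "confined_by \<Gamma> H P"
    and "P \<inter> elliptic_radical bp emb act R \<Gamma> \<subseteq> {id}"
  shows "growth_exponent bp H \<ge> growth_exponent bp \<Gamma> / 2"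
proof -
  have sub: "subgroup \<Gamma> isom_group" using assms(2) by (simp add: discrete_isom_subgroup_def)
  note G = isom_subgroupD[OF sub]
  obtain f where f: "f \<in> \<Gamma>" "contracting_isometry bp f" using assms(6) by blast
  define F where "F n = f [^]\<^bsub>isom_group\<^esub> n" for n :: int
  have fI: "f \<in> carrier isom_group" using f G(1) by (auto simp: isom_group_def)
  obtain L C where L: "L \<ge> 1" and C: "contracting C (range (\<lambda>n. F n bp))"
    and LF: "\<And>m n. \<bar>real_of_int m - real_of_int n\<bar> / L - L \<le> dist (F m bp) (F n bp)"
      "\<And>m n. dist (F m bp) (F n bp) \<le> L * \<bar>real_of_int m - real_of_int n\<bar> + L"
    using f(2) unfolding contracting_isometry_def F_def by blast
  interpret orbit_axis bp \<Gamma> F L "max C 1"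
  proof
    show "F n \<in> \<Gamma>" for n unfolding F_def by (rule group.subgroup_int_pow_closed[OF group_isom_group sub f(1)])
    show "F 0 = id" by (simp add: F_def) (simp add: isom_group_def)
    show "F (m + n) = F m \<circ> F n" for m n
      using group.int_pow_mult[OF group_isom_group fI, of m n] by (simp add: F_def isom_group_def)
    show "contracting (max C 1) (range (\<lambda>n. F n bp))" by (rule contracting_mono[OF C]) simp
  qed (use assms(1) G L LF discrete_isom_finite_ball[OF assms(2)] in auto)
  \<comment> \<open>An orbit within \<open>D\<close> of the axis would make \<Gamma> virtually
    cyclic, against non-elementarity.\<close>
  have spread: "\<exists>k\<in>\<Gamma>. infdist (k bp) (axis id) > D" for D
    using virtually_Z_if_near_axis[OF sub, of D] assms(3) unfolding elementary_group_def by (meson not_le)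
  have conf: "finite P" "P \<subseteq> Isom"
    "\<And>g. g \<in> \<Gamma> \<Longrightarrow> {inv\<^bsub>isom_group\<^esub> g \<circ> h \<circ> g | h. h \<in> H} \<inter> (P - {id}) \<noteq> {}"
    using assms(8) by (auto simp: confined_by_def)
  \<comment> \<open>With the identity removed, every remaining element lies outside the elliptic
    radical and so has a good translate.\<close>
  have fin: "finite (P - {id})" "P - {id} \<subseteq> Isom" using conf by auto
  have P: "\<exists>p\<in>P - {id}. \<exists>h\<in>H. h \<circ> g = g \<circ> p" if g: "g \<in> \<Gamma>" for g
  proof -
    obtain h p where "h \<in> H" "p \<in> P - {id}" "p = inv\<^bsub>isom_group\<^esub> g \<circ> h \<circ> g" using conf(3)[OF g] by blast
    moreover have "inv\<^bsub>isom_group\<^esub> g = inv_into UNIV g" using g G(1) by (auto simp: m_inv_isom_group)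
    then have "g \<circ> (inv\<^bsub>isom_group\<^esub> g \<circ> h \<circ> g) = h \<circ> g" using g by (simp add: fun_eq_iff)
    ultimately show ?thesis by metis
  qed
  have ax: "\<exists>h\<in>\<Gamma>. projects_boundedly (axis h) (orbit_of {z \<in> \<Gamma>. z \<circ> p = p \<circ> z})"
    if p: "p \<in> P - {id}" for p
  proof (rule ccontr)
    assume neg: "\<not> ?thesis"
    have "p \<in> elliptic_radical bp emb act R \<Gamma>"
      using assms(4) neg p conf(2) unfolding convergence_boundary_def
      by (intro elliptic_radicalI[OF spread]) auto
    then show False using p assms(9) by blast
  qed
  obtain K M where KM: "\<And>n. card {h bp |h. h \<in> \<Gamma> \<and> dist bp (h bp) \<le> real n}
    \<le> K * card {h bp |h. h \<in> H \<and> dist bp (h bp) \<le> real (2 * n + M)}"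
    using orbit_count[OF assms(7) fin P ax] by blast
  show ?thesis
    unfolding growth_exponent_def
  proof (rule limsup_ln_comparison)
    show "card {h bp |h. h \<in> \<Gamma> \<and> dist bp (h bp) \<le> real n}
      \<le> K * card {h bp |h. h \<in> H \<and> dist bp (h bp) \<le> real (2 * n + M)}" for n by (rule KM)
    show "0 < card {h bp |h. h \<in> \<Gamma> \<and> dist bp (h bp) \<le> real n}" for n
      unfolding orbit_ball_image using finite_ball[of "real n"] id_mem by (force simp: card_gt_0_iff)
    show "limsup (\<lambda>n. ereal (ln (real (card {h bp |h. h \<in> \<Gamma> \<and> dist bp (h bp) \<le> real n})) / real n)) \<noteq> \<infinity>"
      using assms(5) by (auto simp: divergence_type_def growth_exponent_def)
  qed
qed

end
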